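(* Let $N=(N,\phi,\xi,\eta,g)$ be an almost contact metric manifold and $M=B\times_f\overline{F}$ a nontrivial warped product submanifold of $N$. Assume that $\xi$ is normal to $M$ and $N$ is one of the following three manifolds: cosymplectic, Sasakian, Kenmotsu. Then there does not exist a proper pointwise semi-slant submanifold $M$ of $N$ such that $\mathcal{D}_1=T\overline{F}$ and $\mathcal{D}_2=TB$.
   Context: An almost contact metric manifold $(N,\phi,\xi,\eta,g)$ is a smooth manifold $N$ of dimension $2n+1$ with a tensor field $\phi$ of type $(1,1)$, a vector field $\xi$, a $1$-form $\eta$ and a Riemannian metric $g$ such that $\phi^2=-I+\eta\otimes\xi$, $\eta(\xi)=1$ and $g(\phi X,\phi Y)=g(X,Y)-\eta(X)\eta(Y)$ for all vector fields $X,Y$ (hence $\phi\xi=0$, $\eta\circ\phi=0$, $\eta(X)=g(X,\xi)$). With $\overline{\nabla}$ the Levi-Civita connection of $(N,g)$, the manifold is: cosymplectic iff $\overline{\nabla}\phi=0$; Sasakian iff $(\overline{\nabla}_X\phi)Y=g(X,Y)\xi-\eta(Y)X$; Kenmotsu iff $(\overline{\nabla}_X\phi)Y=g(\phi X,Y)\xi-\eta(Y)\phi X$, for all vector fields $X,Y$ on $N$. A submanifold $M$ of $N$ is a pointwise semi-slant submanifold if there is a distribution $\mathcal{D}_1\subset TM$ on $M$ such that $TM=\mathcal{D}_1\oplus\mathcal{D}_2$, $\phi(\mathcal{D}_1)\subset\mathcal{D}_1$, and at each given point $p\in M$ the angle $\theta=\theta(X)$ between $\phi X$ and the space $(\mathcal{D}_2)_p$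 is constant for nonzero $X\in(\mathcal{D}_2)_p$, where $\mathcal{D}_2$ is the orthogonal complement of $\mathcal{D}_1$ in $TM$. The angle $\theta$, as a function on $M$, is the semi-slant function; $M$ is proper if $\theta$ takes values in $(0,\frac{\pi}{2})$. For Riemannian manifolds $(B,g_B)$, $(\overline{F},g_{\overline{F}})$ and a positive smooth function $f$ on $B$, the warped product manifold $B\times_f\overline{F}$ is the product manifold $B\times\overline{F}$ with the metric $g_B+f^2g_{\overline{F}}$ (pulled back via the projections); $f$ is the warping function, and the warped product is trivial if $f$ is constant. A warped product submanifold is a submanifold which, with the induced metric, is such a warped product. $TB$ and $T\overline{F}$ are identified with the corresponding subbundles of $TM$.
   Formalization: The base B is assumed connected and both factors have positive dimension; otherwise the claim is false, since f may be constant on each component of B without being constant, or the fibre may be a point. *)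

theory Defs
  imports "HOL-Analysis.Analysis"
begin

section \<open>Smooth manifolds\<close>

primrec C_k_on :: "nat \<Rightarrow> 'a::euclidean_space set \<Rightarrow> ('a \<Rightarrow> 'b::real_normed_vector) \<Rightarrow> bool" where
  "C_k_on 0 S f \<longleftrightarrow> continuous_on S f"
| "C_k_on (Suc k) S f \<longleftrightarrow>
     (\<exists>D. (\<forall>x\<in>S. (f has_derivative D x) (at x)) \<and> (\<forall>v. C_k_on k S (\<lambda>x. D x v)))"

text \<open>Only used for open \<open>S\<close>.\<close>
definition smooth_on :: "'a::euclidean_space set \<Rightarrow> ('a \<Rightarrow> 'b::real_normed_vector) \<Rightarrow> bool" where
  "smooth_on S f \<longleftrightarrow> (\<forall>k. C_k_on k S f)"

text \<open>A chart is its domain together with its coordinate map (junk outside the domain).\<close>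
type_synonym ('p, 'e) chart = "'p set \<times> ('p \<Rightarrow> 'e)"

abbreviation dom_chart :: "('p, 'e) chart \<Rightarrow> 'p set" where
  "dom_chart c \<equiv> fst c"

abbreviation coord :: "('p, 'e) chart \<Rightarrow> 'p \<Rightarrow> 'e" where
  "coord c \<equiv> snd c"

definition inv_coord :: "('p, 'e) chart \<Rightarrow> 'e \<Rightarrow> 'p" where
  "inv_coord c = inv_into (dom_chart c) (coord c)"

text \<open>The underlying point set is the whole (Hausdorff, second countable) type; an arbitrary, not
  necessarily maximal, atlas gives the smooth structure. Connectedness is not included.\<close>
definition smooth_manifold ::
    "('p::{t2_space,second_countable_topology}, 'e::euclidean_space) chart set \<Rightarrow> bool" where
  "smooth_manifold A \<longleftrightarrow>
     (\<forall>c\<in>A. open (dom_chart c) \<and> open (coord c ` dom_chart c) \<and>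
        homeomorphism (dom_chart c) (coord c ` dom_chart c) (coord c) (inv_coord c)) \<and>
     (\<Union>c\<in>A. dom_chart c) = UNIV \<and>
     (\<forall>c\<in>A. \<forall>d\<in>A. smooth_on (coord c ` (dom_chart c \<inter> dom_chart d)) (coord d \<circ> inv_coord c))"

definition chart_at :: "('p, 'e) chart set \<Rightarrow> 'p \<Rightarrow> ('p, 'e) chart" where
  "chart_at A p = (SOME c. c \<in> A \<and> p \<in> dom_chart c)"

definition prod_atlas ::
    "('p, 'e) chart set \<Rightarrow> ('q, 'd) chart set \<Rightarrow> ('p \<times> 'q, 'e \<times> 'd) chart set" where
  "prod_atlas A A' =
     {(dom_chart c \<times> dom_chart c', \<lambda>(x, y). (coord c x, coord c' y)) | c c'. c \<in> A \<and> c' \<in> A'}"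

section \<open>Tangent vectors and vector fields\<close>

text \<open>A tangent vector is the family of its components in all charts of the atlas around the base
  point, related by the derivatives of the coordinate changes; the components belonging to other
  charts are \<open>0\<close> by convention. The base point is not recorded in the vector.\<close>
typedef ('p, 'e) tvec = "UNIV :: (('p, 'e) chart \<Rightarrow> 'e) set"
  morphisms components Tvec
  by simp

setup_lifting type_definition_tvec

instantiation tvec :: (type, real_vector) real_vector
begin

lift_definition zero_tvec :: "('a, 'b) tvec" is "\<lambda>c. 0" .
lift_definition plus_tvec :: "('a, 'b) tvec \<Rightarrow> ('a, 'b) tvec \<Rightarrow> ('a, 'b) tvec"
  is "\<lambda>u v c. u c + v c" .
lift_definition minus_tvec :: "('a, 'b) tvec \<Rightarrow> ('a, 'b) tvec \<Rightarrow> ('a, 'b) tvec"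
  is "\<lambda>u v c. u c - v c" .
lift_definition uminus_tvec :: "('a, 'b) tvec \<Rightarrow> ('a, 'b) tvec" is "\<lambda>u c. - u c" .
lift_definition scaleR_tvec :: "real \<Rightarrow> ('a, 'b) tvec \<Rightarrow> ('a, 'b) tvec"
  is "\<lambda>a u c. a *\<^sub>R u c" .

instance
  by standard (transfer; simp add: algebra_simps)+

end

definition tangent_space ::
    "('p, 'e::euclidean_space) chart set \<Rightarrow> 'p \<Rightarrow> ('p, 'e) tvec set" where
  "tangent_space A p =
     {v. (\<forall>c\<in>A. \<forall>d\<in>A. p \<in> dom_chart c \<longrightarrow> p \<in> dom_chart d \<longrightarrow>
            components v d =
              frechet_derivative (coord d \<circ> inv_coord c) (at (coord c p)) (components v c)) \<and>
         (\<forall>c. c \<notin> A \<or> p \<notin> dom_chart c \<longrightarrow> components v c = 0)}"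

definition smooth_fun_on ::
    "('p, 'e::euclidean_space) chart set \<Rightarrow> 'p set \<Rightarrow> ('p \<Rightarrow> real) \<Rightarrow> bool" where
  "smooth_fun_on A W f \<longleftrightarrow>
     (\<forall>c\<in>A. smooth_on (coord c ` (W \<inter> dom_chart c)) (f \<circ> inv_coord c))"

definition smooth_map ::
    "('p::topological_space, 'e::euclidean_space) chart set \<Rightarrow>
     ('q::topological_space, 'd::euclidean_space) chart set \<Rightarrow> ('p \<Rightarrow> 'q) \<Rightarrow> bool" where
  "smooth_map A A' F \<longleftrightarrow> continuous_on UNIV F \<and>
     (\<forall>c\<in>A. \<forall>d\<in>A'. smooth_on (coord c ` (dom_chart c \<inter> F -` dom_chart d))
                               (coord d \<circ> F \<circ> inv_coord c))"

text \<open>Vector fields are only looked at on an open set \<open>W\<close>; their values elsewhere are junk.\<close>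
definition vector_field_on ::
    "('p, 'e::euclidean_space) chart set \<Rightarrow> 'p set \<Rightarrow> ('p \<Rightarrow> ('p, 'e) tvec) \<Rightarrow> bool" where
  "vector_field_on A W X \<longleftrightarrow>
     (\<forall>p\<in>W. X p \<in> tangent_space A p) \<and>
     (\<forall>c\<in>A. smooth_on (coord c ` (W \<inter> dom_chart c)) (\<lambda>x. components (X (inv_coord c x)) c))"

text \<open>\<open>v(f)\<close> for a tangent vector \<open>v\<close> at \<open>p\<close>; independent of the chart chosen.\<close>
definition dir_deriv ::
    "('p, 'e::euclidean_space) chart set \<Rightarrow> 'p \<Rightarrow> ('p, 'e) tvec \<Rightarrow> ('p \<Rightarrow> real) \<Rightarrow> real" where
  "dir_deriv A p v f =
     (let c = chart_at A p
      in frechet_derivative (f \<circ> inv_coord c) (at (coord c p)) (components v c))"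

text \<open>The differential at \<open>p\<close> of a map \<open>F\<close> between manifolds.\<close>
definition differential ::
    "('p, 'e::euclidean_space) chart set \<Rightarrow> ('q, 'd::euclidean_space) chart set \<Rightarrow> ('p \<Rightarrow> 'q) \<Rightarrow>
     'p \<Rightarrow> ('p, 'e) tvec \<Rightarrow> ('q, 'd) tvec" where
  "differential A A' F p v =
     (let c = chart_at A p
      in Tvec (\<lambda>d. if d \<in> A' \<and> F p \<in> dom_chart d
                   then frechet_derivative (coord d \<circ> F \<circ> inv_coord c) (at (coord c p))
                          (components v c)
                   else 0))"

text \<open>In coordinates, \<open>[X, Y] = DY(X) - DX(Y)\<close>.\<close>
definition lie_bracket ::
    "('p, 'e::euclidean_space) chart set \<Rightarrow> ('p \<Rightarrow> ('p, 'e) tvec) \<Rightarrow> ('p \<Rightarrow> ('p, 'e) tvec) \<Rightarrow>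
     'p \<Rightarrow> ('p, 'e) tvec" where
  "lie_bracket A X Y p =
     Tvec (\<lambda>c. if c \<in> A \<and> p \<in> dom_chart c
               then frechet_derivative (\<lambda>x. components (Y (inv_coord c x)) c) (at (coord c p))
                      (components (X p) c) -
                    frechet_derivative (\<lambda>x. components (X (inv_coord c x)) c) (at (coord c p))
                      (components (Y p) c)
               else 0)"

section \<open>Tensor fields, Riemannian metrics and the Levi-Civita connection\<close>

definition linear_on_subspace ::
    "'v::real_vector set \<Rightarrow> ('v \<Rightarrow> 'w::real_vector) \<Rightarrow> bool" where
  "linear_on_subspace S f \<longleftrightarrow>
     (\<forall>u\<in>S. \<forall>v\<in>S. f (u + v) = f u + f v) \<and> (\<forall>a. \<forall>u\<in>S. f (a *\<^sub>R u) = a *\<^sub>R f u)"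

type_synonym ('p, 'e) metric_tensor = "'p \<Rightarrow> ('p, 'e) tvec \<Rightarrow> ('p, 'e) tvec \<Rightarrow> real"

definition riemannian_metric ::
    "('p::topological_space, 'e::euclidean_space) chart set \<Rightarrow> ('p, 'e) metric_tensor \<Rightarrow> bool" where
  "riemannian_metric A g \<longleftrightarrow>
     (\<forall>p. \<forall>u\<in>tangent_space A p.
        linear_on_subspace (tangent_space A p) (g p u) \<and>
        (\<forall>v\<in>tangent_space A p. g p u v = g p v u) \<and>
        (u \<noteq> 0 \<longrightarrow> g p u u > 0)) \<and>
     (\<forall>W X Y. open W \<longrightarrow> vector_field_on A W X \<longrightarrow> vector_field_on A W Y \<longrightarrow>
        smooth_fun_on A W (\<lambda>p. g p (X p) (Y p)))"

definition one_form ::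
    "('p::topological_space, 'e::euclidean_space) chart set \<Rightarrow> ('p \<Rightarrow> ('p, 'e) tvec \<Rightarrow> real) \<Rightarrow> bool" where
  "one_form A \<eta> \<longleftrightarrow>
     (\<forall>p. linear_on_subspace (tangent_space A p) (\<eta> p)) \<and>
     (\<forall>W X. open W \<longrightarrow> vector_field_on A W X \<longrightarrow> smooth_fun_on A W (\<lambda>p. \<eta> p (X p)))"

definition tensor_field_1_1 ::
    "('p::topological_space, 'e::euclidean_space) chart set \<Rightarrow>
     ('p \<Rightarrow> ('p, 'e) tvec \<Rightarrow> ('p, 'e) tvec) \<Rightarrow> bool" where
  "tensor_field_1_1 A \<phi> \<longleftrightarrow>
     (\<forall>p. linear_on_subspace (tangent_space A p) (\<phi> p) \<and>
          \<phi> p ` tangent_space A p \<subseteq> tangent_space A p) \<and>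
     (\<forall>W X. open W \<longrightarrow> vector_field_on A W X \<longrightarrow> vector_field_on A W (\<lambda>p. \<phi> p (X p)))"

type_synonym ('p, 'e) connection =
  "('p \<Rightarrow> ('p, 'e) tvec) \<Rightarrow> ('p \<Rightarrow> ('p, 'e) tvec) \<Rightarrow> 'p \<Rightarrow> ('p, 'e) tvec"

text \<open>A connection acts on vector fields defined on arbitrary open sets \<open>W\<close>. Compatibility with
  restriction to smaller open sets need not be postulated: it follows from the two rules for
  \<open>f X\<close> and \<open>f Y\<close>, since \<open>f\<close> may be the indicator function of a smaller open set.\<close>
definition affine_connection ::
    "('p::topological_space, 'e::euclidean_space) chart set \<Rightarrow> ('p, 'e) connection \<Rightarrow> bool" where
  "affine_connection A nabla \<longleftrightarrow>
     (\<forall>W X Y. open W \<longrightarrow> vector_field_on A W X \<longrightarrow> vector_field_on A W Y \<longrightarrow>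
        vector_field_on A W (nabla X Y) \<and>
        (\<forall>Z. vector_field_on A W Z \<longrightarrow>
           (\<forall>p\<in>W. nabla (\<lambda>q. X q + Z q) Y p = nabla X Y p + nabla Z Y p \<and>
                  nabla X (\<lambda>q. Y q + Z q) p = nabla X Y p + nabla X Z p)) \<and>
        (\<forall>f. smooth_fun_on A W f \<longrightarrow>
           (\<forall>p\<in>W. nabla (\<lambda>q. f q *\<^sub>R X q) Y p = f p *\<^sub>R nabla X Y p \<and>
                  nabla X (\<lambda>q. f q *\<^sub>R Y q) p =
                    dir_deriv A p (X p) f *\<^sub>R Y p + f p *\<^sub>R nabla X Y p)))"

definition levi_civita ::
    "('p::topological_space, 'e::euclidean_space) chart set \<Rightarrow> ('p, 'e) metric_tensor \<Rightarrow>
     ('p, 'e) connection \<Rightarrow> bool" where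
  "levi_civita A g nabla \<longleftrightarrow> affine_connection A nabla \<and>
     (\<forall>W X Y. open W \<longrightarrow> vector_field_on A W X \<longrightarrow> vector_field_on A W Y \<longrightarrow>
        (\<forall>p\<in>W. nabla X Y p - nabla Y X p = lie_bracket A X Y p) \<and>
        (\<forall>Z. vector_field_on A W Z \<longrightarrow>
           (\<forall>p\<in>W. dir_deriv A p (X p) (\<lambda>q. g q (Y q) (Z q)) =
                    g p (nabla X Y p) (Z p) + g p (Y p) (nabla X Z p))))"

section \<open>Almost contact metric manifolds\<close>

definition almost_contact_metric_manifold ::
    "nat \<Rightarrow> ('p::{t2_space,second_countable_topology}, 'e::euclidean_space) chart set \<Rightarrow>
     ('p \<Rightarrow> ('p, 'e) tvec \<Rightarrow> ('p, 'e) tvec) \<Rightarrow> ('p \<Rightarrow> ('p, 'e) tvec) \<Rightarrow>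
     ('p \<Rightarrow> ('p, 'e) tvec \<Rightarrow> real) \<Rightarrow> ('p, 'e) metric_tensor \<Rightarrow> bool" where
  "almost_contact_metric_manifold n A \<phi> \<xi> \<eta> g \<longleftrightarrow>
     smooth_manifold A \<and> DIM('e) = 2 * n + 1 \<and>
     tensor_field_1_1 A \<phi> \<and> vector_field_on A UNIV \<xi> \<and> one_form A \<eta> \<and> riemannian_metric A g \<and>
     (\<forall>p. \<eta> p (\<xi> p) = 1 \<and>
        (\<forall>u\<in>tangent_space A p. \<phi> p (\<phi> p u) = - u + \<eta> p u *\<^sub>R \<xi> p) \<and>
        (\<forall>u\<in>tangent_space A p. \<forall>v\<in>tangent_space A p.
           g p (\<phi> p u) (\<phi> p v) = g p u v - \<eta> p u * \<eta> p v))"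

text \<open>\<open>(\<nabla>\<^sub>X \<phi>) Y = \<nabla>\<^sub>X (\<phi> Y) - \<phi> (\<nabla>\<^sub>X Y)\<close>\<close>
definition cov_deriv_1_1 ::
    "('p, 'e) connection \<Rightarrow> ('p \<Rightarrow> ('p, 'e::real_vector) tvec \<Rightarrow> ('p, 'e) tvec) \<Rightarrow>
     ('p \<Rightarrow> ('p, 'e) tvec) \<Rightarrow> ('p \<Rightarrow> ('p, 'e) tvec) \<Rightarrow> 'p \<Rightarrow> ('p, 'e) tvec" where
  "cov_deriv_1_1 nabla \<phi> X Y p = nabla X (\<lambda>q. \<phi> q (Y q)) p - \<phi> p (nabla X Y p)"

text \<open>In the next three definitions \<open>nabla\<close> is meant to be the Levi-Civita connection of \<open>g\<close>. The
  identities are tensorial, so that requiring them for locally defined fields is the same as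
  requiring them for global ones.\<close>

definition cosymplectic ::
    "('p::topological_space, 'e::euclidean_space) chart set \<Rightarrow> ('p, 'e) connection \<Rightarrow>
     ('p \<Rightarrow> ('p, 'e) tvec \<Rightarrow> ('p, 'e) tvec) \<Rightarrow> bool" where
  "cosymplectic A nabla \<phi> \<longleftrightarrow>
     (\<forall>W X Y. open W \<longrightarrow> vector_field_on A W X \<longrightarrow> vector_field_on A W Y \<longrightarrow>
        (\<forall>p\<in>W. cov_deriv_1_1 nabla \<phi> X Y p = 0))"

definition sasakian ::
    "('p::topological_space, 'e::euclidean_space) chart set \<Rightarrow> ('p, 'e) connection \<Rightarrow>
     ('p \<Rightarrow> ('p, 'e) tvec \<Rightarrow> ('p, 'e) tvec) \<Rightarrow> ('p \<Rightarrow> ('p, 'e) tvec) \<Rightarrow>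
     ('p \<Rightarrow> ('p, 'e) tvec \<Rightarrow> real) \<Rightarrow> ('p, 'e) metric_tensor \<Rightarrow> bool" where
  "sasakian A nabla \<phi> \<xi> \<eta> g \<longleftrightarrow>
     (\<forall>W X Y. open W \<longrightarrow> vector_field_on A W X \<longrightarrow> vector_field_on A W Y \<longrightarrow>
        (\<forall>p\<in>W. cov_deriv_1_1 nabla \<phi> X Y p = g p (X p) (Y p) *\<^sub>R \<xi> p - \<eta> p (Y p) *\<^sub>R X p))"

definition kenmotsu ::
    "('p::topological_space, 'e::euclidean_space) chart set \<Rightarrow> ('p, 'e) connection \<Rightarrow>
     ('p \<Rightarrow> ('p, 'e) tvec \<Rightarrow> ('p, 'e) tvec) \<Rightarrow> ('p \<Rightarrow> ('p, 'e) tvec) \<Rightarrow>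
     ('p \<Rightarrow> ('p, 'e) tvec \<Rightarrow> real) \<Rightarrow> ('p, 'e) metric_tensor \<Rightarrow> bool" where
  "kenmotsu A nabla \<phi> \<xi> \<eta> g \<longleftrightarrow>
     (\<forall>W X Y. open W \<longrightarrow> vector_field_on A W X \<longrightarrow> vector_field_on A W Y \<longrightarrow>
        (\<forall>p\<in>W. cov_deriv_1_1 nabla \<phi> X Y p =
           g p (\<phi> p (X p)) (Y p) *\<^sub>R \<xi> p - \<eta> p (Y p) *\<^sub>R \<phi> p (X p)))"

section \<open>Submanifolds and warped products\<close>

text \<open>A submanifold is given by an immersion of a manifold \<open>M\<close>; injectively immersed and embedded
  submanifolds are special cases.\<close>
definition immersion ::
    "('m::topological_space, 'k::euclidean_space) chart set \<Rightarrow>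
     ('p::topological_space, 'e::euclidean_space) chart set \<Rightarrow> ('m \<Rightarrow> 'p) \<Rightarrow> bool" where
  "immersion M N \<iota> \<longleftrightarrow> smooth_map M N \<iota> \<and>
     (\<forall>p. inj_on (differential M N \<iota> p) (tangent_space M p))"

definition induced_metric ::
    "('m, 'k::euclidean_space) chart set \<Rightarrow> ('p, 'e::euclidean_space) chart set \<Rightarrow>
     ('p, 'e) metric_tensor \<Rightarrow> ('m \<Rightarrow> 'p) \<Rightarrow> ('m, 'k) metric_tensor" where
  "induced_metric M N g \<iota> p u v =
     g (\<iota> p) (differential M N \<iota> p u) (differential M N \<iota> p v)"

definition warped_product_metric ::
    "('b, 'k::euclidean_space) chart set \<Rightarrow> ('b, 'k) metric_tensor \<Rightarrow> ('b \<Rightarrow> real) \<Rightarrow>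
     ('f, 'l::euclidean_space) chart set \<Rightarrow> ('f, 'l) metric_tensor \<Rightarrow>
     ('b \<times> 'f, 'k \<times> 'l) metric_tensor" where
  "warped_product_metric B gB f F gF p u v =
     gB (fst p) (differential (prod_atlas B F) B fst p u) (differential (prod_atlas B F) B fst p v) +
     (f (fst p))\<^sup>2 *
     gF (snd p) (differential (prod_atlas B F) F snd p u) (differential (prod_atlas B F) F snd p v)"

definition warped_product_submanifold ::
    "('p::topological_space, 'e::euclidean_space) chart set \<Rightarrow> ('p, 'e) metric_tensor \<Rightarrow>
     ('b::{t2_space,second_countable_topology}, 'k::euclidean_space) chart set \<Rightarrow>
     ('b, 'k) metric_tensor \<Rightarrow> ('b \<Rightarrow> real) \<Rightarrow>
     ('f::{t2_space,second_countable_topology}, 'l::euclidean_space) chart set \<Rightarrow>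
     ('f, 'l) metric_tensor \<Rightarrow> ('b \<times> 'f \<Rightarrow> 'p) \<Rightarrow> bool" where
  "warped_product_submanifold N g B gB f F gF \<iota> \<longleftrightarrow>
     smooth_manifold B \<and> riemannian_metric B gB \<and>
     smooth_manifold F \<and> riemannian_metric F gF \<and>
     smooth_fun_on B UNIV f \<and> (\<forall>b. f b > 0) \<and>
     immersion (prod_atlas B F) N \<iota> \<and>
     (\<forall>p. \<forall>u\<in>tangent_space (prod_atlas B F) p. \<forall>v\<in>tangent_space (prod_atlas B F) p.
        induced_metric (prod_atlas B F) N g \<iota> p u v = warped_product_metric B gB f F gF p u v)"

text \<open>The subbundles of the tangent bundle of the product that are identified with the tangent
  bundles of the factors: the images under the differentials of \<open>x \<mapsto> (x, y)\<close> and \<open>y \<mapsto> (x, y)\<close>.\<close>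

definition tangent_first ::
    "('b, 'k::euclidean_space) chart set \<Rightarrow> ('f, 'l::euclidean_space) chart set \<Rightarrow>
     'b \<times> 'f \<Rightarrow> ('b \<times> 'f, 'k \<times> 'l) tvec set" where
  "tangent_first B F p =
     differential B (prod_atlas B F) (\<lambda>x. (x, snd p)) (fst p) ` tangent_space B (fst p)"

definition tangent_second ::
    "('b, 'k::euclidean_space) chart set \<Rightarrow> ('f, 'l::euclidean_space) chart set \<Rightarrow>
     'b \<times> 'f \<Rightarrow> ('b \<times> 'f, 'k \<times> 'l) tvec set" where
  "tangent_second B F p =
     differential F (prod_atlas B F) (\<lambda>y. (fst p, y)) (snd p) ` tangent_space F (snd p)"

definition normal_to_submanifold ::
    "('p, 'e::euclidean_space) chart set \<Rightarrow> ('p, 'e) metric_tensor \<Rightarrow>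
     ('m, 'k::euclidean_space) chart set \<Rightarrow> ('m \<Rightarrow> 'p) \<Rightarrow> ('p \<Rightarrow> ('p, 'e) tvec) \<Rightarrow> bool" where
  "normal_to_submanifold N g M \<iota> \<xi> \<longleftrightarrow>
     (\<forall>p. \<forall>v\<in>tangent_space M p. g (\<iota> p) (\<xi> (\<iota> p)) (differential M N \<iota> p v) = 0)"

section \<open>Pointwise semi-slant submanifolds\<close>

text \<open>A distribution is a smooth subbundle of constant rank of the tangent bundle.\<close>
definition distribution ::
    "('m::topological_space, 'k::euclidean_space) chart set \<Rightarrow> ('m \<Rightarrow> ('m, 'k) tvec set) \<Rightarrow> bool" where
  "distribution M D \<longleftrightarrow>
     (\<exists>r. \<forall>p. \<exists>W X. open W \<and> p \<in> W \<and> (\<forall>i<r::nat. vector_field_on M W (X i)) \<and>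
        (\<forall>q\<in>W. inj_on (\<lambda>i. X i q) {..<r} \<and> independent ((\<lambda>i. X i q) ` {..<r}) \<and>
               D q = span ((\<lambda>i. X i q) ` {..<r})))"

text \<open>The angle between a vector \<open>w\<close> and a subspace \<open>V\<close> of an inner product space is the smallest
  angle between \<open>w\<close> and a nonzero vector of \<open>V\<close>.\<close>
definition angle_to_subspace ::
    "('v::real_vector \<Rightarrow> 'v \<Rightarrow> real) \<Rightarrow> 'v \<Rightarrow> 'v set \<Rightarrow> real" where
  "angle_to_subspace g w V =
     Inf {arccos (g w u / (sqrt (g w w) * sqrt (g u u))) | u. u \<in> V \<and> u \<noteq> 0}"

text \<open>\<open>D1\<close>, \<open>D2\<close> are distributions on \<open>M\<close>; \<open>\<phi>\<close> and the angles live in the tangent spaces of \<open>N\<close>,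
  where the tangent spaces of \<open>M\<close> are embedded by the differential of \<open>\<iota>\<close>.\<close>
definition pointwise_semi_slant ::
    "('p::topological_space, 'e::euclidean_space) chart set \<Rightarrow>
     ('p \<Rightarrow> ('p, 'e) tvec \<Rightarrow> ('p, 'e) tvec) \<Rightarrow> ('p, 'e) metric_tensor \<Rightarrow>
     ('m::topological_space, 'k::euclidean_space) chart set \<Rightarrow> ('m \<Rightarrow> 'p) \<Rightarrow>
     ('m \<Rightarrow> ('m, 'k) tvec set) \<Rightarrow> ('m \<Rightarrow> ('m, 'k) tvec set) \<Rightarrow> ('m \<Rightarrow> real) \<Rightarrow> bool" where
  "pointwise_semi_slant N \<phi> g M \<iota> D1 D2 \<theta> \<longleftrightarrow>
     distribution M D1 \<and>
     (\<forall>p. D2 p = {v \<in> tangent_space M p. \<forall>u\<in>D1 p. induced_metric M N g \<iota> p u v = 0} \<and>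
          tangent_space M p = {u + v | u v. u \<in> D1 p \<and> v \<in> D2 p} \<and>
          \<phi> (\<iota> p) ` differential M N \<iota> p ` D1 p \<subseteq> differential M N \<iota> p ` D1 p \<and>
          (\<forall>v\<in>D2 p. v \<noteq> 0 \<longrightarrow>
             angle_to_subspace (g (\<iota> p)) (\<phi> (\<iota> p) (differential M N \<iota> p v))
               (differential M N \<iota> p ` D2 p) = \<theta> p))"

definition proper_pointwise_semi_slant ::
    "('p::topological_space, 'e::euclidean_space) chart set \<Rightarrow>
     ('p \<Rightarrow> ('p, 'e) tvec \<Rightarrow> ('p, 'e) tvec) \<Rightarrow> ('p, 'e) metric_tensor \<Rightarrow>
     ('m::topological_space, 'k::euclidean_space) chart set \<Rightarrow> ('m \<Rightarrow> 'p) \<Rightarrow>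
     ('m \<Rightarrow> ('m, 'k) tvec set) \<Rightarrow> ('m \<Rightarrow> ('m, 'k) tvec set) \<Rightarrow> ('m \<Rightarrow> real) \<Rightarrow> bool" where
  "proper_pointwise_semi_slant N \<phi> g M \<iota> D1 D2 \<theta> \<longleftrightarrow>
     pointwise_semi_slant N \<phi> g M \<iota> D1 D2 \<theta> \<and> (\<forall>p. 0 < \<theta> p \<and> \<theta> p < pi / 2)"

end

theory Submission
  imports Defs
begin

text \<open>The fundamental 2-form \<open>\<Phi>(X, Y) = g(X, \<phi> Y)\<close> of a cosymplectic, Sasakian or Kenmotsu manifold
  satisfies \<open>d\<Phi> = 0\<close> on triples of vectors in the kernel of \<open>\<eta>\<close>, so its pullback \<open>\<Omega>\<close> to a
  submanifold normal to \<open>\<xi>\<close> is closed. If the tangent bundle of the second factor of \<open>B \<times>\<^sub>f F\<close> is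
  \<open>\<phi>\<close>-invariant, then \<open>\<Omega>\<close> vanishes on mixed pairs, and closedness says that for fixed
  \<open>V, W \<in> T\<^sub>yF\<close> the function \<open>b \<mapsto> \<Omega>(V, W) = f(b)\<^sup>2 g\<^sub>F(V, J\<^sub>b W)\<close> is locally constant, where
  \<open>J\<^sub>b\<close> is the restriction of \<open>\<phi>\<close> to the copy of \<open>T\<^sub>yF\<close> at \<open>(b, y)\<close>. Hence \<open>f(b)\<^sup>2 J\<^sub>b\<close> is locally
  constant in \<open>b\<close>; as \<open>J\<^sub>b\<close> is an isometry of \<open>g\<^sub>F\<close>, so is \<open>f\<close>, and \<open>f\<close> is constant.\<close>

section \<open>Smooth maps between Euclidean spaces\<close>

text \<open>The form \<Phi> itself need not be closed: for a Kenmotsu structure its exterior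
  derivative is a multiple of the wedge product of \<eta> and \<Phi>. The obstructing terms contain
  \<xi> or a factor \<eta>, and normality of \<xi> kills both on vectors tangent to the submanifold.
  The obstacle is that \<open>nabla\<close> acts on fields on open sets of \<open>N\<close>, whereas
  fields tangent to an immersed manifold live only along \<open>\<iota>\<close> and need not extend.
  Covariant differentiation is therefore confined to coordinate fields of \<open>N\<close>, and only
  the scalar coefficients of the form are pulled back. This replaces the Gauss formula and the
  second fundamental form; its price is the symmetry of second derivatives. For commuting coordinate
  fields \<open>a\<close> along \<open>B\<close> and \<open>V\<close>, \<open>W\<close> along
  \<open>F\<close>, the exterior derivative of \<Omega> on them is a(\<Omega>(V, W)) + V(\<Omega>(W,
  a)) + W(\<Omega>(a, V)). The mixed coefficients are zero on a whole product chart, not just at one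
  point, so their derivatives vanish too and only the first term survives.\<close>

lemma C_k_on_cong:
  assumes "open S" "\<And>x. x \<in> S \<Longrightarrow> f x = g x" "C_k_on k S f"
  shows "C_k_on k S g"
proof (cases k)
  case 0
  with assms show ?thesis by (auto cong: continuous_on_cong)
next
  case (Suc j)
  with assms obtain D where "\<forall>x\<in>S. (f has_derivative D x) (at x)" "\<forall>v. C_k_on j S (\<lambda>x. D x v)"
    by auto
  then have "\<forall>x\<in>S. (g has_derivative D x) (at x)" "\<forall>v. C_k_on j S (\<lambda>x. D x v)"
    using assms(1,2) has_derivative_transform_within_open[where f = f and g = g] by blast+
  with Suc show ?thesis by auto
qed

lemma C_k_on_subset: "C_k_on k S f \<Longrightarrow> T \<subseteq> S \<Longrightarrow> C_k_on k T f"
proof (induction k arbitrary: f)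
  case 0
  then show ?case by (auto intro: continuous_on_subset)
next
  case (Suc k)
  from Suc.prems obtain D where "\<forall>x\<in>S. (f has_derivative D x) (at x)" "\<forall>v. C_k_on k S (\<lambda>x. D x v)"
    by auto
  with Suc.IH[of "\<lambda>x. D x _"] Suc.prems(2) show ?case by auto
qed

lemma C_k_on_SucD: "C_k_on (Suc k) S f \<Longrightarrow> C_k_on k S f"
proof (induction k arbitrary: f)
  case 0
  then obtain D where "\<forall>x\<in>S. (f has_derivative D x) (at x)" by auto
  then have "continuous_on S f"
    by (intro continuous_at_imp_continuous_on ballI has_derivative_continuous) (rule bspec)
  then show ?case by simp
next
  case (Suc k)
  from Suc.prems obtain D where
    "\<forall>x\<in>S. (f has_derivative D x) (at x)" "\<forall>v. C_k_on (Suc k) S (\<lambda>x. D x v)"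
    unfolding C_k_on.simps(2)[of "Suc k"] by blast
  with Suc.IH show ?case by auto
qed

lemma C_k_on_SucE:
  assumes "C_k_on (Suc k) S f"
  obtains D where "\<And>x. x \<in> S \<Longrightarrow> (f has_derivative D x) (at x)"
    "\<And>v. C_k_on k S (\<lambda>x. D x v)"
  using assms by auto

lemma C_k_on_SucI:
  assumes "\<And>x. x \<in> S \<Longrightarrow> (f has_derivative D x) (at x)" "\<And>v. C_k_on k S (\<lambda>x. D x v)"
  shows "C_k_on (Suc k) S f"
  using assms by auto

lemma C_k_on_const: "C_k_on k S (\<lambda>x. a)"
proof (induction k arbitrary: a)
  case (Suc k)
  show ?case
    by (rule C_k_on_SucI[where D = "\<lambda>x v. 0"]) (auto intro: Suc)
qed simp

lemma C_k_on_bounded_linear: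
  assumes "bounded_linear L" "C_k_on k S f"
  shows "C_k_on k S (\<lambda>x. L (f x))"
  using assms(2)
proof (induction k arbitrary: f)
  case 0
  then show ?case
    using assms(1) by (auto intro: bounded_linear.continuous_on)
next
  case (Suc k)
  from Suc.prems obtain D where D: "\<And>x. x \<in> S \<Longrightarrow> (f has_derivative D x) (at x)"
    "\<And>v. C_k_on k S (\<lambda>x. D x v)" by (rule C_k_on_SucE) blast
  show ?case
    by (rule C_k_on_SucI[where D = "\<lambda>x v. L (D x v)"])
      (auto intro!: Suc.IH D bounded_linear.has_derivative[OF assms(1)])
qed

lemma C_k_on_add:
  assumes "C_k_on k S f" "C_k_on k S g"
  shows "C_k_on k S (\<lambda>x. f x + g x)"
  using assms
proof (induction k arbitrary: f g)
  case 0
  then show ?case by (auto intro: continuous_on_add)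
next
  case (Suc k)
  from Suc.prems(1) obtain D where D: "\<And>x. x \<in> S \<Longrightarrow> (f has_derivative D x) (at x)"
    "\<And>v. C_k_on k S (\<lambda>x. D x v)" by (rule C_k_on_SucE) blast
  from Suc.prems(2) obtain E where E: "\<And>x. x \<in> S \<Longrightarrow> (g has_derivative E x) (at x)"
    "\<And>v. C_k_on k S (\<lambda>x. E x v)" by (rule C_k_on_SucE) blast
  show ?case
    by (rule C_k_on_SucI[where D = "\<lambda>x v. D x v + E x v"])
      (auto intro!: Suc.IH D E has_derivative_add)
qed

lemma C_k_on_sum:
  "finite I \<Longrightarrow> (\<And>i. i \<in> I \<Longrightarrow> C_k_on k S (f i)) \<Longrightarrow> C_k_on k S (\<lambda>x. \<Sum>i\<in>I. f i x)"
  by (induction I rule: finite_induct) (auto intro: C_k_on_add C_k_on_const)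

lemma C_k_on_scaleR:
  assumes "C_k_on k S a" "C_k_on k S f"
  shows "C_k_on k S (\<lambda>x. a x *\<^sub>R f x)"
  using assms
proof (induction k arbitrary: a f)
  case 0
  then show ?case by (auto intro: continuous_on_scaleR)
next
  case (Suc k)
  from Suc.prems(1) obtain D where D: "\<And>x. x \<in> S \<Longrightarrow> (a has_derivative D x) (at x)"
    "\<And>v. C_k_on k S (\<lambda>x. D x v)" by (rule C_k_on_SucE) blast
  from Suc.prems(2) obtain E where E: "\<And>x. x \<in> S \<Longrightarrow> (f has_derivative E x) (at x)"
    "\<And>v. C_k_on k S (\<lambda>x. E x v)" by (rule C_k_on_SucE) blast
  show ?case
    \<comment> \<open>The product rule leaves one factor undifferentiated, so the order of that
      factor is lowered by \<open>C_k_on_SucD\<close> before the induction hypothesis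
      applies.\<close>
    by (rule C_k_on_SucI[where D = "\<lambda>x v. a x *\<^sub>R E x v + D x v *\<^sub>R f x"])
      (auto intro!: Suc.IH C_k_on_add D E Suc.prems[THEN C_k_on_SucD] has_derivative_scaleR)
qed

lemma C_k_on_Pair:
  assumes "C_k_on k S f" "C_k_on k S g"
  shows "C_k_on k S (\<lambda>x. (f x, g x))"
  using assms
proof (induction k arbitrary: f g)
  case 0
  then show ?case by (auto intro: continuous_on_Pair)
next
  case (Suc k)
  from Suc.prems(1) obtain D where D: "\<And>x. x \<in> S \<Longrightarrow> (f has_derivative D x) (at x)"
    "\<And>v. C_k_on k S (\<lambda>x. D x v)" by (rule C_k_on_SucE) blast
  from Suc.prems(2) obtain E where E: "\<And>x. x \<in> S \<Longrightarrow> (g has_derivative E x) (at x)"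
    "\<And>v. C_k_on k S (\<lambda>x. E x v)" by (rule C_k_on_SucE) blast
  show ?case
    by (rule C_k_on_SucI[where D = "\<lambda>x v. (D x v, E x v)"])
      (auto intro!: Suc.IH D E has_derivative_Pair)
qed

lemma C_k_on_compose:
  fixes g :: "'a::euclidean_space \<Rightarrow> 'b::euclidean_space"
  assumes "C_k_on k T f" "C_k_on k S g" "g ` S \<subseteq> T"
  shows "C_k_on k S (f \<circ> g)"
  using assms(1,2)
proof (induction k arbitrary: f)
  case 0
  then show ?case
    using continuous_on_compose[of S g f] continuous_on_subset[OF _ assms(3), of f] by simp
next
  case (Suc k)
  from Suc.prems(1) obtain D where D: "\<And>x. x \<in> T \<Longrightarrow> (f has_derivative D x) (at x)"
    "\<And>v. C_k_on k T (\<lambda>x. D x v)" by (rule C_k_on_SucE) blast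
  from Suc.prems(2) obtain E where E: "\<And>x. x \<in> S \<Longrightarrow> (g has_derivative E x) (at x)"
    "\<And>v. C_k_on k S (\<lambda>x. E x v)" by (rule C_k_on_SucE) blast
  have lin: "linear (D (g x))" if "x \<in> S" for x
    using D(1) assms(3) that has_derivative_linear by blast
  \<comment> \<open>\<open>C_k_on\<close> controls \<open>D\<close> in fixed directions only, but
    the chain rule applies it to the moving vector \<open>E x v\<close>. Expansion in the basis
    leaves fixed directions \<open>i\<close> with coefficients that depend on
    \<open>x\<close>.\<close>
  have exp: "D (g x) w = (\<Sum>i\<in>Basis. (w \<bullet> i) *\<^sub>R D (g x) i)" if "x \<in> S" for x w
  proof -
    have "D (g x) w = D (g x) (\<Sum>i\<in>Basis. (w \<bullet> i) *\<^sub>R i)"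
      by (simp add: euclidean_representation)
    also have "\<dots> = (\<Sum>i\<in>Basis. (w \<bullet> i) *\<^sub>R D (g x) i)"
      using lin[OF that] by (simp add: linear_sum linear_scale)
    finally show ?thesis .
  qed
  show ?case
  proof (rule C_k_on_SucI[where D = "\<lambda>x v. \<Sum>i\<in>Basis. (E x v \<bullet> i) *\<^sub>R D (g x) i"])
    fix x assume x: "x \<in> S"
    then have "(f \<circ> g has_derivative D (g x) \<circ> E x) (at x)"
      using D(1) E(1) assms(3) by (intro diff_chain_at) auto
    moreover have "D (g x) \<circ> E x = (\<lambda>v. \<Sum>i\<in>Basis. (E x v \<bullet> i) *\<^sub>R D (g x) i)"
      unfolding o_def by (rule ext) (rule exp[OF x])
    ultimately show "(f \<circ> g has_derivative (\<lambda>v. \<Sum>i\<in>Basis. (E x v \<bullet> i) *\<^sub>R D (g x) i)) (at x)"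
      by simp
  next
    fix v
    show "C_k_on k S (\<lambda>x. \<Sum>i\<in>Basis. (E x v \<bullet> i) *\<^sub>R D (g x) i)"
      using Suc.IH[OF D(2) C_k_on_SucD[OF Suc.prems(2)]]
      by (auto intro!: C_k_on_sum C_k_on_scaleR C_k_on_bounded_linear[OF bounded_linear_inner_left] E
          simp: o_def)
  qed
qed

lemma smooth_on_differentiable: "smooth_on S f \<Longrightarrow> x \<in> S \<Longrightarrow> f differentiable at x"
proof -
  assume "smooth_on S f" "x \<in> S"
  then have "C_k_on (Suc 0) S f" by (simp only: smooth_on_def)
  with \<open>x \<in> S\<close> show ?thesis by (auto simp: differentiable_def)
qed

text \<open>\<open>C_k_on\<close> hides a possibly different witness \<open>D\<close> at each order;
  uniqueness of the derivative identifies all of them with \<open>frechet_derivative\<close> on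
  \<open>S\<close>.\<close>

lemma smooth_on_frechet_derivative:
  assumes "smooth_on S f" "open S"
  shows "smooth_on S (\<lambda>x. frechet_derivative f (at x) v)"
  unfolding smooth_on_def
proof
  fix k
  from assms(1) have "C_k_on (Suc k) S f" by (simp only: smooth_on_def)
  then obtain D where D: "\<And>x. x \<in> S \<Longrightarrow> (f has_derivative D x) (at x)"
    "\<And>v. C_k_on k S (\<lambda>x. D x v)" by (rule C_k_on_SucE) blast
  show "C_k_on k S (\<lambda>x. frechet_derivative f (at x) v)"
    by (rule C_k_on_cong[OF assms(2) _ D(2)[of v]]) (metis D(1) frechet_derivative_at)
qed

lemma smooth_on_cong:
  "smooth_on S f \<Longrightarrow> open S \<Longrightarrow> (\<And>x. x \<in> S \<Longrightarrow> f x = g x) \<Longrightarrow> smooth_on S g"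
  unfolding smooth_on_def using C_k_on_cong by blast

lemma smooth_on_subset: "smooth_on S f \<Longrightarrow> T \<subseteq> S \<Longrightarrow> smooth_on T f"
  unfolding smooth_on_def using C_k_on_subset by blast

lemma smooth_on_const: "smooth_on S (\<lambda>x. a)"
  unfolding smooth_on_def using C_k_on_const by blast

lemma smooth_on_Pair: "smooth_on S f \<Longrightarrow> smooth_on S g \<Longrightarrow> smooth_on S (\<lambda>x. (f x, g x))"
  unfolding smooth_on_def using C_k_on_Pair by blast

lemma smooth_on_compose:
  fixes g :: "'a::euclidean_space \<Rightarrow> 'b::euclidean_space"
  shows "smooth_on T f \<Longrightarrow> smooth_on S g \<Longrightarrow> g ` S \<subseteq> T \<Longrightarrow> smooth_on S (f \<circ> g)"
  unfolding smooth_on_def using C_k_on_compose by blast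

lemma smooth_on_ident: "smooth_on S (\<lambda>x. x)"
  unfolding smooth_on_def
proof
  fix k show "C_k_on k S (\<lambda>x. x)"
  proof (cases k)
    case (Suc j)
    show ?thesis
      unfolding Suc by (rule C_k_on_SucI[where D = "\<lambda>x v. v"]) (auto intro: C_k_on_const)
  qed (simp add: continuous_on_id)
qed

lemma smooth_on_bounded_linear: "bounded_linear L \<Longrightarrow> smooth_on S L"
  using smooth_on_ident C_k_on_bounded_linear unfolding smooth_on_def by blast

section \<open>Symmetry of second derivatives\<close>

text \<open>The mean value theorem in direction \<open>v\<close> turns the second difference into a
  first difference of \<open>D _ v\<close>, and differentiability of the latter at the single point
  \<open>x\<close> gives the limit.\<close>

lemma second_difference_tendsto:
  fixes f :: "'a::real_normed_vector \<Rightarrow> real"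
  assumes "open S" "x \<in> S" and D: "\<And>y. y \<in> S \<Longrightarrow> (f has_derivative D y) (at y)"
    and E: "((\<lambda>y. D y v) has_derivative E) (at x)"
  shows "((\<lambda>t. (f (x + t *\<^sub>R v + t *\<^sub>R w) - f (x + t *\<^sub>R v) - f (x + t *\<^sub>R w) + f x) / t\<^sup>2)
    \<longlongrightarrow> E w) (at_right 0)"
proof (rule tendstoI)
  fix e :: real assume "e > 0"
  \<comment> \<open>\<open>t * K\<close> bounds the norm of every displacement
    \<open>s *\<^sub>R v + u *\<^sub>R w\<close> with \<open>s\<close>, \<open>u\<close> between 0
    and \<open>t\<close>; the summand 1 keeps \<open>K\<close> positive when both vectors are
    zero.\<close>
  define K where "K = norm v + norm w + 1"
  have K: "K > 0" "norm v \<le> K" "norm w \<le> K" by (auto simp: K_def add_nonneg_pos)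
  interpret E: bounded_linear E using E by (rule has_derivative_bounded_linear)
  obtain r where r: "r > 0" "ball x r \<subseteq> S" using assms openE by blast
  \<comment> \<open>The linear approximation is used at two points, each with error at most
    \<open>\<epsilon> * (t * K)\<close>. Together this is two thirds of \<open>t * e\<close>, which
    leaves a strict inequality.\<close>
  define \<epsilon> where "\<epsilon> = e / (3 * K)"
  have "\<epsilon> > 0" using \<open>e > 0\<close> K by (simp add: \<epsilon>_def)
  then obtain d where d: "d > 0"
    "\<And>y. norm (y - x) < d \<Longrightarrow> norm (D y v - D x v - E (y - x)) \<le> \<epsilon> * norm (y - x)"
    using E unfolding has_derivative_at_alt by blast
  define \<delta> where "\<delta> = min d r / K"
  have "\<delta> > 0" using d r K by (simp add: \<delta>_def)
  show "eventually (\<lambda>t. dist ((f (x + t *\<^sub>R v + t *\<^sub>R w) - f (x + t *\<^sub>R v) - f (x + t *\<^sub>R w) + f x) / t\<^sup>2)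
      (E w) < e) (at_right 0)"
  proof (rule eventually_at_rightI[OF _ \<open>\<delta> > 0\<close>])
    fix t assume "t \<in> {0<..<\<delta>}"
    then have t: "t > 0" "t < \<delta>" by auto
    have tK: "t * K < d" "t * K < r"
      using t K by (auto simp: \<delta>_def pos_less_divide_eq)
    have small: "norm (s *\<^sub>R v + u *\<^sub>R w) \<le> t * K" if "0 \<le> s" "s \<le> t" "0 \<le> u" "u \<le> t" for s u
    proof -
      have "norm (s *\<^sub>R v + u *\<^sub>R w) \<le> s * norm v + u * norm w"
        using that by (intro norm_triangle_le) auto
      also have "\<dots> \<le> t * norm v + t * norm w"
        using that by (intro add_mono mult_right_mono) auto
      also have "\<dots> \<le> t * K" using t by (simp add: K_def algebra_simps)
      finally show ?thesis .
    qed
    have inS: "x + s *\<^sub>R v + u *\<^sub>R w \<in> S" if "0 \<le> s" "s \<le> t" "0 \<le> u" "u \<le> t" for s u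
    proof -
      have "x + s *\<^sub>R v + u *\<^sub>R w \<in> ball x r"
        using small[OF that] tK norm_minus_cancel[of "s *\<^sub>R v + u *\<^sub>R w"]
        by (simp add: dist_norm add.assoc del: norm_minus_cancel)
      then show ?thesis using r by blast
    qed
    have approx: "\<bar>D (x + s *\<^sub>R v + u *\<^sub>R w) v - D x v - E (s *\<^sub>R v + u *\<^sub>R w)\<bar> \<le> \<epsilon> * (t * K)"
      if "0 \<le> s" "s \<le> t" "0 \<le> u" "u \<le> t" for s u
    proof -
      have "\<bar>D (x + s *\<^sub>R v + u *\<^sub>R w) v - D x v - E (s *\<^sub>R v + u *\<^sub>R w)\<bar>
          \<le> \<epsilon> * norm (s *\<^sub>R v + u *\<^sub>R w)"
        using d(2)[of "x + s *\<^sub>R v + u *\<^sub>R w"] small[OF that] tK by (simp add: add.assoc)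
      also have "\<dots> \<le> \<epsilon> * (t * K)"
        using small[OF that] \<open>\<epsilon> > 0\<close> by (intro mult_left_mono) auto
      finally show ?thesis .
    qed
    \<comment> \<open>Both evaluations of \<open>D _ v\<close> delivered by the mean value theorem
      use the same intermediate \<open>s\<close>, so the contributions
      \<open>E (s *\<^sub>R v)\<close> cancel and \<open>t * E w\<close> remains.\<close>
    define h where "h s = f (x + s *\<^sub>R v + t *\<^sub>R w) - f (x + s *\<^sub>R v)" for s
    have h': "(h has_derivative (\<lambda>a. a * (D (x + s *\<^sub>R v + t *\<^sub>R w) v - D (x + s *\<^sub>R v) v)))
        (at s within {0..t})" if "0 \<le> s" "s \<le> t" for s
    proof -
      have 1: "((\<lambda>s. x + s *\<^sub>R v + u *\<^sub>R w) has_derivative (\<lambda>a. a *\<^sub>R v)) (at s within {0..t})" for u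
        by (auto intro!: derivative_eq_intros)
      have 2: "((\<lambda>s. f (x + s *\<^sub>R v + u *\<^sub>R w)) has_derivative
          (\<lambda>a. D (x + s *\<^sub>R v + u *\<^sub>R w) (a *\<^sub>R v))) (at s within {0..t})" if u: "0 \<le> u" "u \<le> t" for u
        using has_derivative_compose[OF 1[of u] D[OF inS[OF \<open>0 \<le> s\<close> \<open>s \<le> t\<close> u]]] by simp
      have 3: "D (x + s *\<^sub>R v + u *\<^sub>R w) (a *\<^sub>R v) = a * D (x + s *\<^sub>R v + u *\<^sub>R w) v"
        if u: "0 \<le> u" "u \<le> t" for u a
        using has_derivative_linear[OF D[OF inS[OF \<open>0 \<le> s\<close> \<open>s \<le> t\<close> u]]] linear_scale by fastforce
      from has_derivative_diff[OF 2[of t] 2[of 0]] 3[of t] 3[of 0] t show ?thesis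
        by (simp add: h_def[abs_def] algebra_simps)
    qed
    obtain s where s: "s \<in> {0<..<t}"
      "h t - h 0 = (t - 0) * (D (x + s *\<^sub>R v + t *\<^sub>R w) v - D (x + s *\<^sub>R v) v)"
      using mvt_simple[OF t(1) h'] by blast
    have eq: "f (x + t *\<^sub>R v + t *\<^sub>R w) - f (x + t *\<^sub>R v) - f (x + t *\<^sub>R w) + f x
        = t * (D (x + s *\<^sub>R v + t *\<^sub>R w) v - D (x + s *\<^sub>R v) v)"
      using s(2) by (simp add: h_def)
    have "\<bar>D (x + s *\<^sub>R v + t *\<^sub>R w) v - D (x + s *\<^sub>R v) v - t * E w\<bar> \<le> 2 * (\<epsilon> * (t * K))"
      using approx[of s t] approx[of s 0] s t by (simp add: E.add E.scaleR)
    also have "2 * (\<epsilon> * (t * K)) < t * e"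
      using K t \<open>e > 0\<close> by (simp add: \<epsilon>_def field_simps)
    finally have *: "\<bar>D (x + s *\<^sub>R v + t *\<^sub>R w) v - D (x + s *\<^sub>R v) v - t * E w\<bar> < t * e" .
    have "(f (x + t *\<^sub>R v + t *\<^sub>R w) - f (x + t *\<^sub>R v) - f (x + t *\<^sub>R w) + f x) / t\<^sup>2 - E w
        = (D (x + s *\<^sub>R v + t *\<^sub>R w) v - D (x + s *\<^sub>R v) v - t * E w) / t"
      unfolding eq using t by (simp add: field_simps power2_eq_square)
    then show "dist ((f (x + t *\<^sub>R v + t *\<^sub>R w) - f (x + t *\<^sub>R v) - f (x + t *\<^sub>R w) + f x) / t\<^sup>2) (E w) < e"
      using * t unfolding dist_real_def by (simp add: abs_divide pos_divide_less_eq mult.commute)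
  qed
qed

text \<open>The second difference quotient is invariant under exchanging \<open>v\<close> and
  \<open>w\<close>, so its two limits coincide. Taking components first is what allows the mean
  value theorem, which fails for vector values.\<close>

lemma symmetric_second_derivative:
  fixes f :: "'a::real_normed_vector \<Rightarrow> 'b::euclidean_space"
  assumes "open S" "x \<in> S" and D: "\<And>y. y \<in> S \<Longrightarrow> (f has_derivative D y) (at y)"
    and E: "((\<lambda>y. D y v) has_derivative E) (at x)"
    and E': "((\<lambda>y. D y w) has_derivative E') (at x)"
  shows "E w = E' v"
proof (rule euclidean_eqI)
  fix i :: 'b assume "i \<in> Basis"
  have "((\<lambda>t. (f (x + t *\<^sub>R v + t *\<^sub>R w) \<bullet> i - f (x + t *\<^sub>R v) \<bullet> i - f (x + t *\<^sub>R w) \<bullet> i + f x \<bullet> i) / t\<^sup>2)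
      \<longlongrightarrow> E w \<bullet> i) (at_right 0)"
    by (rule second_difference_tendsto[OF assms(1,2), where D = "\<lambda>y w. D y w \<bullet> i"])
      (auto intro!: derivative_eq_intros D E)
  moreover have "((\<lambda>t. (f (x + t *\<^sub>R w + t *\<^sub>R v) \<bullet> i - f (x + t *\<^sub>R w) \<bullet> i - f (x + t *\<^sub>R v) \<bullet> i
      + f x \<bullet> i) / t\<^sup>2) \<longlongrightarrow> E' v \<bullet> i) (at_right 0)"
    by (rule second_difference_tendsto[OF assms(1,2), where D = "\<lambda>y w. D y w \<bullet> i"])
      (auto intro!: derivative_eq_intros D E')
  moreover have "(\<lambda>t. (f (x + t *\<^sub>R v + t *\<^sub>R w) \<bullet> i - f (x + t *\<^sub>R v) \<bullet> i - f (x + t *\<^sub>R w) \<bullet> i + f x \<bullet> i) / t\<^sup>2)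
     = (\<lambda>t. (f (x + t *\<^sub>R w + t *\<^sub>R v) \<bullet> i - f (x + t *\<^sub>R w) \<bullet> i - f (x + t *\<^sub>R v) \<bullet> i
      + f x \<bullet> i) / t\<^sup>2)"
    by (simp add: algebra_simps)
  ultimately show "E w \<bullet> i = E' v \<bullet> i"
    using tendsto_unique[OF trivial_limit_at_right_real] by simp
qed

section \<open>Coordinate vector fields and differentials\<close>

lemma inv_coord_coord [simp]:
  assumes "smooth_manifold A" "c \<in> A" "p \<in> dom_chart c"
  shows "inv_coord c (coord c p) = p"
  using assms unfolding smooth_manifold_def by (auto simp: homeomorphism_def)

lemma inv_coord_in_dom:
  assumes "smooth_manifold A" "c \<in> A" "x \<in> coord c ` dom_chart c"
  shows "inv_coord c x \<in> dom_chart c"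
  using assms by auto

lemma open_dom_chart: "smooth_manifold A \<Longrightarrow> c \<in> A \<Longrightarrow> open (dom_chart c)"
  unfolding smooth_manifold_def by blast

lemma chart_homeomorphism:
  "smooth_manifold A \<Longrightarrow> c \<in> A \<Longrightarrow>
    homeomorphism (dom_chart c) (coord c ` dom_chart c) (coord c) (inv_coord c)"
  unfolding smooth_manifold_def by blast

lemma open_coord_image:
  assumes A: "smooth_manifold A" and c: "c \<in> A" and "open W"
  shows "open (coord c ` (dom_chart c \<inter> W))"
proof -
  have "openin (top_of_set (coord c ` dom_chart c)) (coord c ` (dom_chart c \<inter> W))"
    using homeomorphism_imp_open_map[OF chart_homeomorphism[OF A c]] \<open>open W\<close>
    by (simp add: openin_open_Int)
  moreover have "open (coord c ` dom_chart c)"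
    using A c unfolding smooth_manifold_def by blast
  ultimately show ?thesis using openin_open_trans by blast
qed

lemma chart_exists:
  assumes "smooth_manifold A"
  obtains c where "c \<in> A" "p \<in> dom_chart c"
  using assms unfolding smooth_manifold_def by blast

lemma chart_at_in:
  assumes "smooth_manifold A"
  shows "chart_at A p \<in> A" "p \<in> dom_chart (chart_at A p)"
proof -
  have "\<exists>c. c \<in> A \<and> p \<in> dom_chart c" using chart_exists[OF assms] by metis
  then show "chart_at A p \<in> A" "p \<in> dom_chart (chart_at A p)"
    unfolding chart_at_def by (metis (mono_tags, lifting) someI_ex)+
qed

lemma smooth_map_transition:
  assumes "smooth_map A A' F" "c \<in> A" "d \<in> A'"
  shows "smooth_on (coord c ` (dom_chart c \<inter> F -` dom_chart d)) (coord d \<circ> F \<circ> inv_coord c)"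
  using assms unfolding smooth_map_def by blast

lemma open_transition_domain:
  fixes F :: "'p::{t2_space,second_countable_topology} \<Rightarrow> 'q::{t2_space,second_countable_topology}"
  assumes "smooth_manifold A" "smooth_manifold A'" "smooth_map A A' F" "c \<in> A" "d \<in> A'"
  shows "open (coord c ` (dom_chart c \<inter> F -` dom_chart d))"
proof (rule open_coord_image[OF assms(1,4)])
  show "open (F -` dom_chart d)"
    using assms(3) open_dom_chart[OF assms(2,5)] unfolding smooth_map_def
    by (intro open_vimage) auto
qed

lemma smooth_map_differentiable:
  assumes "smooth_map A A' F" "c \<in> A" "d \<in> A'" "p \<in> dom_chart c" "F p \<in> dom_chart d"
  shows "(coord d \<circ> F \<circ> inv_coord c) differentiable at (coord c p)"
  using smooth_map_transition[OF assms(1-3)] assms(4,5) by (auto intro: smooth_on_differentiable)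

lemma smooth_map_id: "smooth_manifold A \<Longrightarrow> smooth_map A A id"
  unfolding smooth_map_def smooth_manifold_def by auto

text \<open>The chain rule in charts. The inner factor \<open>inv_coord d \<circ> coord d\<close> is
  the identity only where \<open>F\<close> lands in \<open>dom_chart d\<close>, so the two
  coordinate expressions are compared on an open neighbourhood.\<close>

lemma frechet_derivative_chart_compose:
  assumes A: "smooth_manifold A" "smooth_manifold A'"
    and F: "smooth_map A A' F" and G: "smooth_map A' A'' G"
    and c: "c \<in> A" "p \<in> dom_chart c" and d: "d \<in> A'" "F p \<in> dom_chart d"
    and e: "e \<in> A''" "G (F p) \<in> dom_chart e"
  shows "frechet_derivative (coord e \<circ> (G \<circ> F) \<circ> inv_coord c) (at (coord c p)) v =
    frechet_derivative (coord e \<circ> G \<circ> inv_coord d) (at (coord d (F p)))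
      (frechet_derivative (coord d \<circ> F \<circ> inv_coord c) (at (coord c p)) v)"
proof -
  let ?f = "coord d \<circ> F \<circ> inv_coord c" and ?g = "coord e \<circ> G \<circ> inv_coord d"
  have fp: "?f (coord c p) = coord d (F p)" using A c by simp
  have f: "?f differentiable at (coord c p)" by (rule smooth_map_differentiable[OF F c(1) d(1) c(2) d(2)])
  have g: "?g differentiable at (?f (coord c p))"
    unfolding fp by (rule smooth_map_differentiable[OF G d(1) e(1) d(2) e(2)])
  have "frechet_derivative (?g \<circ> ?f) (at (coord c p)) =
      frechet_derivative (coord e \<circ> (G \<circ> F) \<circ> inv_coord c) (at (coord c p))"
  proof (rule frechet_derivative_transform_within_open)
    show "?g \<circ> ?f differentiable at (coord c p)" by (rule differentiable_chain_at[OF f g])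
    show "open (coord c ` (dom_chart c \<inter> F -` dom_chart d))"
      using open_coord_image[OF A(1) c(1)] F open_dom_chart[OF A(2) d(1)] open_vimage
      unfolding smooth_map_def by blast
    show "coord c p \<in> coord c ` (dom_chart c \<inter> F -` dom_chart d)" using c d by auto
    show "(?g \<circ> ?f) x = (coord e \<circ> (G \<circ> F) \<circ> inv_coord c) x"
      if "x \<in> coord c ` (dom_chart c \<inter> F -` dom_chart d)" for x
      using that A c d by auto
  qed
  then show ?thesis
    using frechet_derivative_compose[OF f g] fp by (metis comp_apply)
qed

lemma frechet_derivative_transition_self:
  assumes "smooth_manifold A" "c \<in> A" "p \<in> dom_chart c"
  shows "frechet_derivative (coord c \<circ> inv_coord c) (at (coord c p)) v = v"
proof -
  have "frechet_derivative (\<lambda>x. x) (at (coord c p)) =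
      frechet_derivative (coord c \<circ> inv_coord c) (at (coord c p))"
    by (rule frechet_derivative_transform_within_open[where X = "coord c ` (dom_chart c \<inter> UNIV)"])
      (use assms open_coord_image[OF assms(1,2) open_UNIV] in auto)
  then show ?thesis by (metis frechet_derivative_ident)
qed

section \<open>Tangent vectors and the coordinate frame\<close>

lemma tangent_space_components:
  assumes "v \<in> tangent_space A p" "c \<in> A" "d \<in> A" "p \<in> dom_chart c" "p \<in> dom_chart d"
  shows "components v d =
    frechet_derivative (coord d \<circ> inv_coord c) (at (coord c p)) (components v c)"
  using assms unfolding tangent_space_def by blast

lemma tangent_space_components_outside:
  "v \<in> tangent_space A p \<Longrightarrow> d \<notin> A \<or> p \<notin> dom_chart d \<Longrightarrow> components v d = 0"
  unfolding tangent_space_def by blast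

text \<open>One component determines all others: in charts around \<open>p\<close> through the
  transition derivatives, in all other charts through the convention that components are 0.\<close>

lemma tangent_space_eqI:
  assumes "u \<in> tangent_space A p" "v \<in> tangent_space A p" "c \<in> A" "p \<in> dom_chart c"
    and "components u c = components v c"
  shows "u = v"
proof -
  have "components u d = components v d" for d
  proof (cases "d \<in> A \<and> p \<in> dom_chart d")
    case True
    then show ?thesis using assms by (metis tangent_space_components)
  next
    case False
    then have "d \<notin> A \<or> p \<notin> dom_chart d" by blast
    then show ?thesis
      by (simp add: tangent_space_components_outside[OF assms(1)] tangent_space_components_outside[OF assms(2)])
  qed
  then show ?thesis by (intro components_inject[THEN iffD1] ext)
qed

text \<open>For fixed \<open>v\<close>, a coordinate vector field of the chart \<open>c\<close>.\<close>
definition coord_vec ::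
    "('p, 'e::euclidean_space) chart set \<Rightarrow> ('p, 'e) chart \<Rightarrow> 'e \<Rightarrow> 'p \<Rightarrow> ('p, 'e) tvec" where
  "coord_vec A c v p = Tvec (\<lambda>d. if d \<in> A \<and> p \<in> dom_chart d
     then frechet_derivative (coord d \<circ> inv_coord c) (at (coord c p)) v else 0)"

lemma components_coord_vec:
  "components (coord_vec A c v p) d = (if d \<in> A \<and> p \<in> dom_chart d
     then frechet_derivative (coord d \<circ> inv_coord c) (at (coord c p)) v else 0)"
  by (simp add: coord_vec_def Tvec_inverse)

lemma components_coord_vec_self [simp]:
  assumes "smooth_manifold A" "c \<in> A" "p \<in> dom_chart c"
  shows "components (coord_vec A c v p) c = v"
  using assms by (simp add: components_coord_vec frechet_derivative_transition_self)

text \<open>The cocycle rule for coordinate changes, which makes the family of components in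
  \<open>coord_vec\<close> a genuine tangent vector.\<close>

lemma frechet_derivative_transition_compose:
  assumes A: "smooth_manifold A" and "c \<in> A" "d \<in> A" "e \<in> A"
    and "p \<in> dom_chart c" "p \<in> dom_chart d" "p \<in> dom_chart e"
  shows "frechet_derivative (coord e \<circ> inv_coord c) (at (coord c p)) v =
    frechet_derivative (coord e \<circ> inv_coord d) (at (coord d p))
      (frechet_derivative (coord d \<circ> inv_coord c) (at (coord c p)) v)"
  using frechet_derivative_chart_compose[OF A A smooth_map_id[OF A] smooth_map_id[OF A],
      of c p d e v] assms by simp

lemma coord_vec_in_tangent_space:
  assumes "smooth_manifold A" "c \<in> A" "p \<in> dom_chart c"
  shows "coord_vec A c v p \<in> tangent_space A p"
  using assms unfolding tangent_space_def
  by (auto simp: components_coord_vec intro!: frechet_derivative_transition_compose)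

text \<open>Every tangent vector at \<open>p\<close> is the value of a coordinate field of any given
  chart around \<open>p\<close>, so identities between tangent vectors can be checked on
  \<open>coord_vec\<close>.\<close>

lemma coord_vec_components:
  assumes "smooth_manifold A" "c \<in> A" "p \<in> dom_chart c" "v \<in> tangent_space A p"
  shows "coord_vec A c (components v c) p = v"
  using assms by (intro tangent_space_eqI[of _ A p _ c] coord_vec_in_tangent_space) auto

lemma transition_differentiable:
  assumes "smooth_manifold A" "c \<in> A" "d \<in> A" "p \<in> dom_chart c" "p \<in> dom_chart d"
  shows "(coord d \<circ> inv_coord c) differentiable at (coord c p)"
  using smooth_map_differentiable[OF smooth_map_id[OF assms(1)] assms(2,3,4)] assms(5) by simp

lemma linear_frechet_derivative: "f differentiable at x \<Longrightarrow> linear (frechet_derivative f (at x))"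
  by (metis frechet_derivative_works has_derivative_linear)

lemma linear_transition:
  assumes "smooth_manifold A" "c \<in> A" "d \<in> A" "p \<in> dom_chart c" "p \<in> dom_chart d"
  shows "linear (frechet_derivative (coord d \<circ> inv_coord c) (at (coord c p)))"
  by (rule linear_frechet_derivative[OF transition_differentiable[OF assms]])

lemma components_eqI: "(\<And>d. components u d = components v d) \<Longrightarrow> u = v"
  by (rule components_inject[THEN iffD1]) (rule ext)

lemma components_add [simp]: "components (u + v) d = components u d + components v d"
  by (simp add: plus_tvec.rep_eq)

lemma components_diff [simp]: "components (u - v) d = components u d - components v d"
  by (simp add: minus_tvec.rep_eq)

lemma components_scaleR [simp]: "components (a *\<^sub>R v) d = a *\<^sub>R components v d"
  by (simp add: scaleR_tvec.rep_eq)

lemma components_zero [simp]: "components 0 d = 0"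
  by (simp add: zero_tvec.rep_eq)

lemma subspace_tangent_space:
  assumes "smooth_manifold A"
  shows "subspace (tangent_space A p)"
proof (rule subspaceI)
  note lin = linear_transition[OF assms, of _ _ p]
  show "0 \<in> tangent_space A p"
    unfolding tangent_space_def using lin by (simp add: linear_0)
  fix u v :: "('a, 'b) tvec" and a :: real
  assume u: "u \<in> tangent_space A p"
  have "components (a *\<^sub>R u) d =
      frechet_derivative (coord d \<circ> inv_coord c) (at (coord c p)) (components (a *\<^sub>R u) c)"
    if cd: "c \<in> A" "d \<in> A" "p \<in> dom_chart c" "p \<in> dom_chart d" for c d
    unfolding components_scaleR tangent_space_components[OF u cd] linear_scale[OF lin[OF cd]] ..
  moreover have "components (a *\<^sub>R u) d = 0" if "d \<notin> A \<or> p \<notin> dom_chart d" for d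
    by (simp add: tangent_space_components_outside[OF u that])
  ultimately show "a *\<^sub>R u \<in> tangent_space A p"
    unfolding tangent_space_def by blast
  assume v: "v \<in> tangent_space A p"
  have "components (u + v) d =
      frechet_derivative (coord d \<circ> inv_coord c) (at (coord c p)) (components (u + v) c)"
    if cd: "c \<in> A" "d \<in> A" "p \<in> dom_chart c" "p \<in> dom_chart d" for c d
    unfolding components_add tangent_space_components[OF u cd] tangent_space_components[OF v cd]
      linear_add[OF lin[OF cd]] ..
  moreover have "components (u + v) d = 0" if "d \<notin> A \<or> p \<notin> dom_chart d" for d
    by (simp add: tangent_space_components_outside[OF u that] tangent_space_components_outside[OF v that])
  ultimately show "u + v \<in> tangent_space A p"
    unfolding tangent_space_def by blast
qed

lemma linear_coord_vec:
  assumes "smooth_manifold A" "c \<in> A" "p \<in> dom_chart c"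
  shows "linear (\<lambda>v. coord_vec A c v p)"
proof (rule linearI)
  show "coord_vec A c (u + v) p = coord_vec A c u p + coord_vec A c v p" for u v
    using linear_transition[OF assms(1,2) _ assms(3)]
    by (intro components_eqI) (simp add: components_coord_vec linear_add)
  show "coord_vec A c (a *\<^sub>R v) p = a *\<^sub>R coord_vec A c v p" for a v
    using linear_transition[OF assms(1,2) _ assms(3)]
    by (intro components_eqI) (simp add: components_coord_vec linear_scale)
qed

text \<open>In another chart \<open>d\<close> the component is a directional derivative of the
  transition from \<open>c\<close> to \<open>d\<close>, evaluated at the point in
  \<open>c\<close>-coordinates. It is thus a composition with the reverse transition, smooth because
  derivatives of smooth maps are.\<close>

lemma vector_field_coord_vec:
  assumes A: "smooth_manifold A" and c: "c \<in> A"
  shows "vector_field_on A (dom_chart c) (coord_vec A c v)"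
  unfolding vector_field_on_def
proof (intro conjI ballI)
  fix p assume "p \<in> dom_chart c"
  then show "coord_vec A c v p \<in> tangent_space A p" by (rule coord_vec_in_tangent_space[OF A c])
next
  fix d assume d: "d \<in> A"
  let ?S = "coord d ` (dom_chart d \<inter> dom_chart c)" and ?T = "coord c ` (dom_chart c \<inter> dom_chart d)"
  have S: "open ?S" "open ?T" using open_coord_image[OF A] c d open_dom_chart[OF A] by auto
  have cd: "smooth_on ?T (coord d \<circ> inv_coord c)" and dc: "smooth_on ?S (coord c \<circ> inv_coord d)"
    using A c d unfolding smooth_manifold_def by blast+
  have "smooth_on ?S ((\<lambda>x. frechet_derivative (coord d \<circ> inv_coord c) (at x) v) \<circ> (coord c \<circ> inv_coord d))"
    by (rule smooth_on_compose[OF smooth_on_frechet_derivative[OF cd S(2)] dc])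
      (use A d in auto)
  then have "smooth_on ?S (\<lambda>x. components (coord_vec A c v (inv_coord d x)) d)"
    by (rule smooth_on_cong[OF _ S(1)]) (use A d in \<open>auto simp: components_coord_vec\<close>)
  then show "smooth_on (coord d ` (dom_chart c \<inter> dom_chart d))
      (\<lambda>x. components (coord_vec A c v (inv_coord d x)) d)"
    by (simp only: Int_commute)
qed

text \<open>\<open>differential\<close> is defined through the arbitrarily selected chart
  \<open>chart_at A p\<close>; the chain rule with the identity as first map shows that any chart
  around \<open>p\<close> gives the same result.\<close>

lemma components_differential:
  assumes A: "smooth_manifold A" and A': "smooth_manifold A'" and F: "smooth_map A A' F"
    and c: "c \<in> A" "p \<in> dom_chart c" and d: "d \<in> A'" "F p \<in> dom_chart d"
    and v: "v \<in> tangent_space A p"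
  shows "components (differential A A' F p v) d =
    frechet_derivative (coord d \<circ> F \<circ> inv_coord c) (at (coord c p)) (components v c)"
proof -
  let ?c = "chart_at A p"
  note c' = chart_at_in[OF A, of p]
  have "components (differential A A' F p v) d =
      frechet_derivative (coord d \<circ> F \<circ> inv_coord ?c) (at (coord ?c p)) (components v ?c)"
    using d by (simp add: differential_def Let_def Tvec_inverse)
  also have "components v ?c =
      frechet_derivative (coord ?c \<circ> inv_coord c) (at (coord c p)) (components v c)"
    using tangent_space_components[OF v c(1) c'(1) c(2) c'(2)] .
  also have "frechet_derivative (coord d \<circ> F \<circ> inv_coord ?c) (at (coord ?c p)) \<dots> =
      frechet_derivative (coord d \<circ> F \<circ> inv_coord c) (at (coord c p)) (components v c)"
    using frechet_derivative_chart_compose[OF A A smooth_map_id[OF A] F c, of ?c d "components v c"]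
      c' d by simp
  finally show ?thesis .
qed

lemma differential_coord_vec:
  assumes A: "smooth_manifold A" and A': "smooth_manifold A'" and F: "smooth_map A A' F"
    and c: "c \<in> A" "p \<in> dom_chart c" and d: "d \<in> A'" "F p \<in> dom_chart d"
  shows "differential A A' F p (coord_vec A c v p) =
    coord_vec A' d (frechet_derivative (coord d \<circ> F \<circ> inv_coord c) (at (coord c p)) v) (F p)"
proof (rule components_eqI)
  fix e
  show "components (differential A A' F p (coord_vec A c v p)) e =
    components (coord_vec A' d (frechet_derivative (coord d \<circ> F \<circ> inv_coord c) (at (coord c p)) v) (F p)) e"
  proof (cases "e \<in> A' \<and> F p \<in> dom_chart e")
    case True
    then show ?thesis
      using components_differential[OF A A' F c, of e "coord_vec A c v p"]
        coord_vec_in_tangent_space[OF A c] components_coord_vec_self[OF A c]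
        frechet_derivative_chart_compose[OF A A' F smooth_map_id[OF A'] c d, of e v]
      by (simp add: components_coord_vec)
  next
    case False
    then show ?thesis by (auto simp: components_coord_vec differential_def Let_def Tvec_inverse)
  qed
qed

lemma differential_in_tangent_space:
  assumes A: "smooth_manifold A" and A': "smooth_manifold A'" and F: "smooth_map A A' F"
    and v: "v \<in> tangent_space A p"
  shows "differential A A' F p v \<in> tangent_space A' (F p)"
proof -
  note c = chart_at_in[OF A, of p] and d = chart_at_in[OF A', of "F p"]
  show ?thesis
    using differential_coord_vec[OF A A' F c d, of "components v (chart_at A p)"]
      coord_vec_components[OF A c v] coord_vec_in_tangent_space[OF A' d]
    by simp
qed

lemma differential_compose:
  assumes A: "smooth_manifold A" and A': "smooth_manifold A'" and A'': "smooth_manifold A''"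
    and F: "smooth_map A A' F" and G: "smooth_map A' A'' G" and GF: "smooth_map A A'' (G \<circ> F)"
    and v: "v \<in> tangent_space A p"
  shows "differential A' A'' G (F p) (differential A A' F p v) = differential A A'' (G \<circ> F) p v"
proof -
  note c = chart_at_in[OF A, of p] and d = chart_at_in[OF A', of "F p"]
    and e = chart_at_in[OF A'', of "G (F p)"]
  have e': "(G \<circ> F) p \<in> dom_chart (chart_at A'' (G (F p)))" using e by simp
  define w where "w = components v (chart_at A p)"
  have "v = coord_vec A (chart_at A p) w p"
    using coord_vec_components[OF A c v] by (simp add: w_def)
  note v_eq = this
  show ?thesis
    unfolding v_eq differential_coord_vec[OF A A' F c d] differential_coord_vec[OF A' A'' G d e]
      differential_coord_vec[OF A A'' GF c e(1) e'] frechet_derivative_chart_compose[OF A A' F G c d e]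
      comp_apply[of G F p] ..
qed

lemma differential_id:
  assumes A: "smooth_manifold A" and v: "v \<in> tangent_space A p"
  shows "differential A A (\<lambda>x. x) p v = v"
proof -
  note c = chart_at_in[OF A, of p]
  show ?thesis
    using differential_coord_vec[OF A A smooth_map_id[OF A, unfolded id_def] c c,
        of "components v (chart_at A p)"]
      coord_vec_components[OF A c v]
      frechet_derivative_transition_self[OF A c, of "components v (chart_at A p)"]
    by (simp add: o_def)
qed

lemma differential_const: "differential A A' (\<lambda>x. q) p v = 0"
  by (rule components_eqI) (simp add: differential_def Let_def Tvec_inverse o_def)

section \<open>Product manifolds\<close>

definition prod_chart :: "('p, 'e) chart \<Rightarrow> ('q, 'd) chart \<Rightarrow> ('p \<times> 'q, 'e \<times> 'd) chart" where
  "prod_chart c c' = (dom_chart c \<times> dom_chart c', \<lambda>(x, y). (coord c x, coord c' y))"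

lemma prod_atlas_eq: "prod_atlas A A' = {prod_chart c c' | c c'. c \<in> A \<and> c' \<in> A'}"
  by (simp add: prod_atlas_def prod_chart_def)

lemma dom_prod_chart [simp]: "dom_chart (prod_chart c c') = dom_chart c \<times> dom_chart c'"
  by (simp add: prod_chart_def)

lemma coord_prod_chart [simp]: "coord (prod_chart c c') = (\<lambda>(x, y). (coord c x, coord c' y))"
  by (simp add: prod_chart_def)

lemma coord_prod_chart_image:
  "coord (prod_chart c c') ` (S \<times> T) = (coord c ` S) \<times> (coord c' ` T)"
  by force

text \<open>\<open>inv_coord\<close> is an \<open>inv_into\<close> and picks some preimage, so the
  formula rests on injectivity of the product chart on its domain.\<close>

lemma inv_coord_prod_chart:
  assumes A: "smooth_manifold A" "c \<in> A" and A': "smooth_manifold A'" "c' \<in> A'"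
    and x: "x \<in> coord c ` dom_chart c" and y: "y \<in> coord c' ` dom_chart c'"
  shows "inv_coord (prod_chart c c') (x, y) = (inv_coord c x, inv_coord c' y)"
proof -
  have inj: "inj_on (coord (prod_chart c c')) (dom_chart (prod_chart c c'))"
  proof (rule inj_onI)
    fix p q assume pq: "p \<in> dom_chart (prod_chart c c')" "q \<in> dom_chart (prod_chart c c')"
      and eq: "coord (prod_chart c c') p = coord (prod_chart c c') q"
    from eq have "coord c (fst p) = coord c (fst q)" "coord c' (snd p) = coord c' (snd q)"
      by (auto simp: case_prod_beta)
    with pq A A' have "fst p = fst q" "snd p = snd q"
      by (metis inv_coord_coord dom_prod_chart mem_Times_iff)+
    then show "p = q" by (simp add: prod_eq_iff)
  qed
  have "(inv_coord c x, inv_coord c' y) \<in> dom_chart (prod_chart c c')"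
    using inv_coord_in_dom[OF A x] inv_coord_in_dom[OF A' y] by simp
  moreover have "coord (prod_chart c c') (inv_coord c x, inv_coord c' y) = (x, y)"
    using A A' x y by auto
  ultimately show ?thesis
    unfolding inv_coord_def[of "prod_chart c c'"] using inj by (metis inv_into_f_f)
qed

lemma smooth_on_comp_fst:
  fixes f :: "'a::euclidean_space \<Rightarrow> 'c::real_normed_vector"
  assumes "smooth_on S f"
  shows "smooth_on (S \<times> (T :: 'b::euclidean_space set)) (\<lambda>z. f (fst z))"
  using smooth_on_compose[OF assms smooth_on_bounded_linear[OF bounded_linear_fst], of "S \<times> T"]
  by (force simp: o_def)

lemma smooth_on_comp_snd:
  fixes f :: "'b::euclidean_space \<Rightarrow> 'c::real_normed_vector"
  assumes "smooth_on T f"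
  shows "smooth_on ((S :: 'a::euclidean_space set) \<times> T) (\<lambda>z. f (snd z))"
  using smooth_on_compose[OF assms smooth_on_bounded_linear[OF bounded_linear_snd], of "S \<times> T"]
  by (force simp: o_def)

lemma smooth_manifold_prod_atlas:
  assumes A: "smooth_manifold A" and A': "smooth_manifold A'"
  shows "smooth_manifold (prod_atlas A A')"
  unfolding smooth_manifold_def
proof (intro conjI ballI)
  fix C assume "C \<in> prod_atlas A A'"
  then obtain c c' where C: "C = prod_chart c c'" "c \<in> A" "c' \<in> A'" by (auto simp: prod_atlas_eq)
  have im: "coord C ` dom_chart C = (coord c ` dom_chart c) \<times> (coord c' ` dom_chart c')"
    unfolding C dom_prod_chart by (rule coord_prod_chart_image)
  show "open (dom_chart C)"
    using open_Times[OF open_dom_chart[OF A C(2)] open_dom_chart[OF A' C(3)]] C by simp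
  show "open (coord C ` dom_chart C)"
    unfolding im
    using open_Times[OF open_coord_image[OF A C(2) open_UNIV] open_coord_image[OF A' C(3) open_UNIV]]
    by simp
  show "homeomorphism (dom_chart C) (coord C ` dom_chart C) (coord C) (inv_coord C)"
  proof (rule homeomorphismI)
    have c: "continuous_on (dom_chart c) (coord c)" "continuous_on (dom_chart c') (coord c')"
      "continuous_on (coord c ` dom_chart c) (inv_coord c)"
      "continuous_on (coord c' ` dom_chart c') (inv_coord c')"
      using chart_homeomorphism A A' C unfolding homeomorphism_def by blast+
    have "continuous_on (dom_chart c \<times> dom_chart c') (\<lambda>p. (coord c (fst p), coord c' (snd p)))"
      by (intro continuous_on_Pair continuous_on_compose2[OF c(1)] continuous_on_compose2[OF c(2)]
          continuous_on_fst continuous_on_snd continuous_on_id) auto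
    then show "continuous_on (dom_chart C) (coord C)"
      by (simp add: C case_prod_beta')
    have "continuous_on (coord C ` dom_chart C) (\<lambda>p. (inv_coord c (fst p), inv_coord c' (snd p)))"
      unfolding im
      by (intro continuous_on_Pair continuous_on_compose2[OF c(3)] continuous_on_compose2[OF c(4)]
          continuous_on_fst continuous_on_snd continuous_on_id) auto
    then show "continuous_on (coord C ` dom_chart C) (inv_coord C)"
    proof (rule continuous_on_eq)
      fix z assume "z \<in> coord C ` dom_chart C"
      then have "fst z \<in> coord c ` dom_chart c" "snd z \<in> coord c' ` dom_chart c'"
        unfolding im by auto
      from inv_coord_prod_chart[OF A C(2) A' C(3) this]
      show "(inv_coord c (fst z), inv_coord c' (snd z)) = inv_coord C z"
        by (simp add: C(1))
    qed
    show inv: "inv_coord C (coord C p) = p" if "p \<in> dom_chart C" for p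
    proof -
      from that have p: "fst p \<in> dom_chart c" "snd p \<in> dom_chart c'" by (auto simp: C(1))
      from inv_coord_prod_chart[OF A C(2) A' C(3) imageI[OF p(1)] imageI[OF p(2)]]
      show ?thesis
        by (simp add: C(1) case_prod_beta inv_coord_coord[OF A C(2) p(1)] inv_coord_coord[OF A' C(3) p(2)])
    qed
    show "inv_coord C ` coord C ` dom_chart C \<subseteq> dom_chart C"
      using inv by (auto simp del: coord_prod_chart)
    show "coord C (inv_coord C x) = x" if "x \<in> coord C ` dom_chart C" for x
      using that inv by (auto simp del: coord_prod_chart)
  qed simp
next
  show "(\<Union>C\<in>prod_atlas A A'. dom_chart C) = UNIV"
  proof -
    have "\<exists>C\<in>prod_atlas A A'. (x, y) \<in> dom_chart C" for x y
    proof -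
      obtain c where "c \<in> A" "x \<in> dom_chart c" using chart_exists[OF A] .
      moreover obtain c' where "c' \<in> A'" "y \<in> dom_chart c'" using chart_exists[OF A'] .
      ultimately show ?thesis
        unfolding prod_atlas_eq by (intro bexI[of _ "prod_chart c c'"]) (simp, blast)
    qed
    then show ?thesis by auto
  qed
next
  fix C D assume "C \<in> prod_atlas A A'" "D \<in> prod_atlas A A'"
  then obtain c c' d d' where C: "C = prod_chart c c'" "c \<in> A" "c' \<in> A'"
    and D: "D = prod_chart d d'" "d \<in> A" "d' \<in> A'" by (auto simp: prod_atlas_eq)
  let ?S = "coord c ` (dom_chart c \<inter> dom_chart d)" and ?T = "coord c' ` (dom_chart c' \<inter> dom_chart d')"
  have im: "coord C ` (dom_chart C \<inter> dom_chart D) = ?S \<times> ?T"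
    unfolding C D dom_prod_chart Times_Int_Times by (rule coord_prod_chart_image)
  have S: "open (?S \<times> ?T)"
    using open_coord_image[OF A C(2)] open_coord_image[OF A' C(3)]
      open_dom_chart[OF A D(2)] open_dom_chart[OF A' D(3)] by (simp add: open_Times)
  have "smooth_on ?S (coord d \<circ> inv_coord c)" "smooth_on ?T (coord d' \<circ> inv_coord c')"
    using A A' C D unfolding smooth_manifold_def by blast+
  then have "smooth_on (?S \<times> ?T)
      (\<lambda>z. ((coord d \<circ> inv_coord c) (fst z), (coord d' \<circ> inv_coord c') (snd z)))"
    by (intro smooth_on_Pair smooth_on_comp_fst smooth_on_comp_snd)
  then show "smooth_on (coord C ` (dom_chart C \<inter> dom_chart D)) (coord D \<circ> inv_coord C)"
    unfolding im by (rule smooth_on_cong[OF _ S])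
      (auto simp: C(1) D(1) inv_coord_prod_chart[OF A C(2) A' C(3)] simp del: inv_coord_coord)
qed

lemma smooth_map_fst:
  assumes A: "smooth_manifold A" and A': "smooth_manifold A'"
  shows "smooth_map (prod_atlas A A') A fst"
  unfolding smooth_map_def
proof (intro conjI ballI)
  fix C d assume "C \<in> prod_atlas A A'" and d: "d \<in> A"
  then obtain c c' where C: "C = prod_chart c c'" "c \<in> A" "c' \<in> A'" by (auto simp: prod_atlas_eq)
  let ?S = "coord c ` (dom_chart c \<inter> dom_chart d)" and ?T = "coord c' ` (dom_chart c' \<inter> UNIV)"
  have "dom_chart C \<inter> fst -` dom_chart d = (dom_chart c \<inter> dom_chart d) \<times> dom_chart c'"
    by (auto simp: C)
  then have im: "coord C ` (dom_chart C \<inter> fst -` dom_chart d) = ?S \<times> ?T"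
    using coord_prod_chart_image C by auto
  have S: "open (?S \<times> ?T)"
    using open_coord_image[OF A C(2) open_dom_chart[OF A d]] open_coord_image[OF A' C(3) open_UNIV]
    by (rule open_Times)
  have "smooth_on ?S (coord d \<circ> inv_coord c)"
    using A C d unfolding smooth_manifold_def by blast
  then have "smooth_on (?S \<times> ?T) (\<lambda>z. (coord d \<circ> inv_coord c) (fst z))"
    by (rule smooth_on_comp_fst)
  then show "smooth_on (coord C ` (dom_chart C \<inter> fst -` dom_chart d)) (coord d \<circ> fst \<circ> inv_coord C)"
    unfolding im by (rule smooth_on_cong[OF _ S])
      (auto simp: C(1) inv_coord_prod_chart[OF A C(2) A' C(3)] simp del: inv_coord_coord)
qed (auto intro: continuous_on_fst)

lemma smooth_map_snd:
  assumes A: "smooth_manifold A" and A': "smooth_manifold A'"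
  shows "smooth_map (prod_atlas A A') A' snd"
  unfolding smooth_map_def
proof (intro conjI ballI)
  fix C d assume "C \<in> prod_atlas A A'" and d: "d \<in> A'"
  then obtain c c' where C: "C = prod_chart c c'" "c \<in> A" "c' \<in> A'" by (auto simp: prod_atlas_eq)
  let ?S = "coord c ` (dom_chart c \<inter> UNIV)" and ?T = "coord c' ` (dom_chart c' \<inter> dom_chart d)"
  have "dom_chart C \<inter> snd -` dom_chart d = dom_chart c \<times> (dom_chart c' \<inter> dom_chart d)"
    by (auto simp: C)
  then have im: "coord C ` (dom_chart C \<inter> snd -` dom_chart d) = ?S \<times> ?T"
    using coord_prod_chart_image C by auto
  have S: "open (?S \<times> ?T)"
    using open_coord_image[OF A C(2) open_UNIV] open_coord_image[OF A' C(3) open_dom_chart[OF A' d]]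
    by (rule open_Times)
  have "smooth_on ?T (coord d \<circ> inv_coord c')"
    using A' C d unfolding smooth_manifold_def by blast
  then have "smooth_on (?S \<times> ?T) (\<lambda>z. (coord d \<circ> inv_coord c') (snd z))"
    by (rule smooth_on_comp_snd)
  then show "smooth_on (coord C ` (dom_chart C \<inter> snd -` dom_chart d)) (coord d \<circ> snd \<circ> inv_coord C)"
    unfolding im by (rule smooth_on_cong[OF _ S])
      (auto simp: C(1) inv_coord_prod_chart[OF A C(2) A' C(3)] simp del: inv_coord_coord)
qed (auto intro: continuous_on_snd)

lemma smooth_map_Pair_left:
  assumes A: "smooth_manifold A" and A': "smooth_manifold A'"
  shows "smooth_map A (prod_atlas A A') (\<lambda>x. (x, y))"
  unfolding smooth_map_def
proof (intro conjI ballI)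
  fix c D assume c: "c \<in> A" and "D \<in> prod_atlas A A'"
  then obtain d d' where D: "D = prod_chart d d'" "d \<in> A" "d' \<in> A'" by (auto simp: prod_atlas_eq)
  have "smooth_on (coord c ` (dom_chart c \<inter> dom_chart d)) (coord d \<circ> inv_coord c)"
    using A c D unfolding smooth_manifold_def by blast
  from smooth_on_Pair[OF this smooth_on_const[of _ "coord d' y"]]
  have "smooth_on (coord c ` (dom_chart c \<inter> (\<lambda>x. (x, y)) -` dom_chart D))
      (\<lambda>x. ((coord d \<circ> inv_coord c) x, coord d' y))"
    by (rule smooth_on_subset) (auto simp: D)
  then show "smooth_on (coord c ` (dom_chart c \<inter> (\<lambda>x. (x, y)) -` dom_chart D))
      (coord D \<circ> (\<lambda>x. (x, y)) \<circ> inv_coord c)"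
    by (simp add: D o_def)
qed (auto intro: continuous_on_Pair)

lemma smooth_map_Pair_right:
  assumes A: "smooth_manifold A" and A': "smooth_manifold A'"
  shows "smooth_map A' (prod_atlas A A') (\<lambda>y. (x, y))"
  unfolding smooth_map_def
proof (intro conjI ballI)
  fix c D assume c: "c \<in> A'" and "D \<in> prod_atlas A A'"
  then obtain d d' where D: "D = prod_chart d d'" "d \<in> A" "d' \<in> A'" by (auto simp: prod_atlas_eq)
  have "smooth_on (coord c ` (dom_chart c \<inter> dom_chart d')) (coord d' \<circ> inv_coord c)"
    using A' c D unfolding smooth_manifold_def by blast
  from smooth_on_Pair[OF smooth_on_const[of _ "coord d x"] this]
  have "smooth_on (coord c ` (dom_chart c \<inter> (\<lambda>y. (x, y)) -` dom_chart D))
      (\<lambda>y. (coord d x, (coord d' \<circ> inv_coord c) y))"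
    by (rule smooth_on_subset) (auto simp: D)
  then show "smooth_on (coord c ` (dom_chart c \<inter> (\<lambda>y. (x, y)) -` dom_chart D))
      (coord D \<circ> (\<lambda>y. (x, y)) \<circ> inv_coord c)"
    by (simp add: D o_def)
qed (auto intro: continuous_on_Pair)

text \<open>Links coordinate directions in a product chart with the slice differentials that define
  \<open>tangent_first\<close>. Constant-coefficient fields on the product thereby become fields
  adapted to the splitting.\<close>

lemma coord_vec_prod_left:
  assumes A: "smooth_manifold A" "c \<in> A" "x \<in> dom_chart c"
    and A': "smooth_manifold A'" "c' \<in> A'" "y \<in> dom_chart c'"
  shows "coord_vec (prod_atlas A A') (prod_chart c c') (v, 0) (x, y) =
    differential A (prod_atlas A A') (\<lambda>x. (x, y)) x (coord_vec A c v x)"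
proof -
  have C: "prod_chart c c' \<in> prod_atlas A A'" "(x, y) \<in> dom_chart (prod_chart c c')"
    using assms unfolding prod_atlas_eq by (blast, simp)
  have 1: "coord (prod_chart c c') \<circ> (\<lambda>x. (x, y)) \<circ> inv_coord c =
      (\<lambda>z. ((coord c \<circ> inv_coord c) z, coord c' y))"
    by (simp add: o_def)
  have "(coord c \<circ> inv_coord c has_derivative frechet_derivative (coord c \<circ> inv_coord c) (at (coord c x)))
      (at (coord c x))"
    using transition_differentiable[OF A(1,2,2,3,3)] frechet_derivative_works by blast
  then have "((\<lambda>z. ((coord c \<circ> inv_coord c) z, coord c' y)) has_derivative (\<lambda>v. (v, 0))) (at (coord c x))"
    using frechet_derivative_transition_self[OF A]
    by (auto intro!: derivative_eq_intros simp: o_def)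
  then have "frechet_derivative (coord (prod_chart c c') \<circ> (\<lambda>x. (x, y)) \<circ> inv_coord c) (at (coord c x)) v = (v, 0)"
    unfolding 1 by (metis frechet_derivative_at)
  then show ?thesis
    using differential_coord_vec[OF A(1) smooth_manifold_prod_atlas[OF A(1) A'(1)]
        smooth_map_Pair_left[OF A(1) A'(1)] A(2,3) C] by simp
qed

lemma coord_vec_prod_right:
  assumes A: "smooth_manifold A" "c \<in> A" "x \<in> dom_chart c"
    and A': "smooth_manifold A'" "c' \<in> A'" "y \<in> dom_chart c'"
  shows "coord_vec (prod_atlas A A') (prod_chart c c') (0, v) (x, y) =
    differential A' (prod_atlas A A') (\<lambda>y. (x, y)) y (coord_vec A' c' v y)"
proof -
  have C: "prod_chart c c' \<in> prod_atlas A A'" "(x, y) \<in> dom_chart (prod_chart c c')"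
    using assms unfolding prod_atlas_eq by (blast, simp)
  have 1: "coord (prod_chart c c') \<circ> (\<lambda>y. (x, y)) \<circ> inv_coord c' =
      (\<lambda>z. (coord c x, (coord c' \<circ> inv_coord c') z))"
    by (simp add: o_def)
  have "(coord c' \<circ> inv_coord c' has_derivative frechet_derivative (coord c' \<circ> inv_coord c') (at (coord c' y)))
      (at (coord c' y))"
    using transition_differentiable[OF A'(1,2,2,3,3)] frechet_derivative_works by blast
  then have "((\<lambda>z. (coord c x, (coord c' \<circ> inv_coord c') z)) has_derivative (\<lambda>v. (0, v))) (at (coord c' y))"
    using frechet_derivative_transition_self[OF A']
    by (auto intro!: derivative_eq_intros simp: o_def)
  then have "frechet_derivative (coord (prod_chart c c') \<circ> (\<lambda>y. (x, y)) \<circ> inv_coord c') (at (coord c' y)) v = (0, v)"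
    unfolding 1 by (metis frechet_derivative_at)
  then show ?thesis
    using differential_coord_vec[OF A'(1) smooth_manifold_prod_atlas[OF A(1) A'(1)]
        smooth_map_Pair_right[OF A(1) A'(1)] A'(2,3) C] by simp
qed

section \<open>Pullback of closed 2-forms\<close>

lemma bilinear_euclidean_expansion:
  fixes P :: "'e::euclidean_space \<Rightarrow> 'd::euclidean_space \<Rightarrow> real"
  assumes "bilinear P"
  shows "P s t = (\<Sum>i\<in>Basis. \<Sum>j\<in>Basis. (s \<bullet> i) * ((t \<bullet> j) * P i j))"
proof -
  have "P s t = P (\<Sum>i\<in>Basis. (s \<bullet> i) *\<^sub>R i) (\<Sum>j\<in>Basis. (t \<bullet> j) *\<^sub>R j)"
    by (simp only: euclidean_representation)
  also have "\<dots> = (\<Sum>(i, j)\<in>Basis \<times> Basis. P ((s \<bullet> i) *\<^sub>R i) ((t \<bullet> j) *\<^sub>R j))"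
    by (rule bilinear_sum[OF assms])
  also have "\<dots> = (\<Sum>i\<in>Basis. \<Sum>j\<in>Basis. (s \<bullet> i) * ((t \<bullet> j) * P i j))"
    by (simp add: sum.cartesian_product bilinear_lmul[OF assms] bilinear_rmul[OF assms]
        mult.left_commute)
  finally show ?thesis .
qed

text \<open>\<open>P'\<close> differentiates the coefficients for fixed arguments only, while
  \<open>D y v\<close> and \<open>D y w\<close> move with \<open>y\<close>. Basis expansion gives
  finite sums of scalar products, to which the Leibniz rule applies: one term for the base point and
  one for each slot.\<close>

lemma has_derivative_pullback_form:
  fixes P :: "'e::euclidean_space \<Rightarrow> 'e \<Rightarrow> 'e \<Rightarrow> real" and u :: "'m::real_normed_vector \<Rightarrow> 'e"
  assumes U: "open U" "\<And>z. z \<in> U \<Longrightarrow> bilinear (P z)"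
    and S: "open S" "x \<in> S" "u ` S \<subseteq> U"
    and P': "\<And>s t. ((\<lambda>z. P z s t) has_derivative P' s t) (at (u x))"
    and D: "(u has_derivative D x) (at x)"
    and E: "\<And>v. ((\<lambda>y. D y v) has_derivative E v) (at x)"
  shows "((\<lambda>y. P (u y) (D y v) (D y w)) has_derivative
    (\<lambda>a. P' (D x v) (D x w) (D x a) + P (u x) (E v a) (D x w) + P (u x) (D x v) (E w a))) (at x)"
proof -
  have ux: "u x \<in> U" using S by blast
  have 1: "((\<lambda>y. P (u y) i j) has_derivative (\<lambda>a. P' i j (D x a))) (at x)" for i j
    using has_derivative_compose[OF D P'] .
  have "((\<lambda>y. \<Sum>i\<in>Basis. \<Sum>j\<in>Basis. (D y v \<bullet> i) * ((D y w \<bullet> j) * P (u y) i j)) has_derivative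
      (\<lambda>a. \<Sum>i\<in>Basis. \<Sum>j\<in>Basis. (D x v \<bullet> i) * ((D x w \<bullet> j) * P' i j (D x a) + (E w a \<bullet> j) * P (u x) i j)
        + (E v a \<bullet> i) * ((D x w \<bullet> j) * P (u x) i j))) (at x)"
    by (intro has_derivative_sum has_derivative_mult has_derivative_inner_left E 1)
  then have 2: "((\<lambda>y. P (u y) (D y v) (D y w)) has_derivative
      (\<lambda>a. \<Sum>i\<in>Basis. \<Sum>j\<in>Basis. (D x v \<bullet> i) * ((D x w \<bullet> j) * P' i j (D x a) + (E w a \<bullet> j) * P (u x) i j)
        + (E v a \<bullet> i) * ((D x w \<bullet> j) * P (u x) i j))) (at x)"
  proof (rule has_derivative_transform_within_open[OF _ S(1,2)])
    fix y assume "y \<in> S"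
    then have "bilinear (P (u y))" using S U by blast
    then show "(\<Sum>i\<in>Basis. \<Sum>j\<in>Basis. (D y v \<bullet> i) * ((D y w \<bullet> j) * P (u y) i j)) = P (u y) (D y v) (D y w)"
      by (rule bilinear_euclidean_expansion[symmetric])
  qed
  \<comment> \<open>Reassembling the sum needs \<open>P' s t\<close> to be bilinear in
    \<open>s\<close> and \<open>t\<close>. This is inherited from \<open>P\<close>, because
    derivatives are unique.\<close>
  have 3: "P' s t = (\<lambda>h. \<Sum>i\<in>Basis. \<Sum>j\<in>Basis. (s \<bullet> i) * ((t \<bullet> j) * P' i j h))" for s t
  proof (rule has_derivative_unique[OF P'])
    have "((\<lambda>z. \<Sum>i\<in>Basis. \<Sum>j\<in>Basis. (s \<bullet> i) * ((t \<bullet> j) * P z i j)) has_derivative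
        (\<lambda>h. \<Sum>i\<in>Basis. \<Sum>j\<in>Basis. (s \<bullet> i) * ((t \<bullet> j) * P' i j h))) (at (u x))"
      by (intro has_derivative_sum has_derivative_mult_right P')
    then show "((\<lambda>z. P z s t) has_derivative
        (\<lambda>h. \<Sum>i\<in>Basis. \<Sum>j\<in>Basis. (s \<bullet> i) * ((t \<bullet> j) * P' i j h))) (at (u x))"
      by (rule has_derivative_transform_within_open[OF _ U(1) ux])
        (rule bilinear_euclidean_expansion[OF U(2), symmetric])
  qed
  have "(\<Sum>i\<in>Basis. \<Sum>j\<in>Basis. (D x v \<bullet> i) * ((D x w \<bullet> j) * P' i j (D x a) + (E w a \<bullet> j) * P (u x) i j)
        + (E v a \<bullet> i) * ((D x w \<bullet> j) * P (u x) i j))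
    = P' (D x v) (D x w) (D x a) + P (u x) (E v a) (D x w) + P (u x) (D x v) (E w a)" for a
    unfolding fun_cong[OF 3[of "D x v" "D x w"]]
      bilinear_euclidean_expansion[OF U(2)[OF ux], of "E v a" "D x w"]
      bilinear_euclidean_expansion[OF U(2)[OF ux], of "D x v" "E w a"]
    by (simp only: sum.distrib distrib_left ac_simps)
  with 2 show ?thesis by simp
qed

text \<open>The second derivatives of \<open>u\<close> cancel in the cyclic sum since they are symmetric and \<open>P\<close> is
  alternating: pullback commutes with the exterior derivative.\<close>
lemma pullback_closed_form:
  fixes P :: "'e::euclidean_space \<Rightarrow> 'e \<Rightarrow> 'e \<Rightarrow> real" and u :: "'m::euclidean_space \<Rightarrow> 'e"
  assumes U: "open U" "\<And>z. z \<in> U \<Longrightarrow> bilinear (P z)"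
    and S: "open S" "x \<in> S" "u ` S \<subseteq> U" and u: "smooth_on S u"
    and P': "\<And>s t. ((\<lambda>z. P z s t) has_derivative P' s t) (at (u x))"
    and anti: "\<And>s t. P (u x) s t = - P (u x) t s"
    and closed: "\<And>a v w. let D = frechet_derivative u (at x) in
      P' (D v) (D w) (D a) + P' (D w) (D a) (D v) + P' (D a) (D v) (D w) = 0"
  obtains Q' where
    "\<And>v w. ((\<lambda>y. P (u y) (frechet_derivative u (at y) v) (frechet_derivative u (at y) w))
       has_derivative Q' v w) (at x)"
    "\<And>a v w. Q' v w a + Q' w a v + Q' a v w = 0"
proof
  define D where "D y = frechet_derivative u (at y)" for y
  define D2 where "D2 v = frechet_derivative (\<lambda>y. D y v) (at x)" for v
  define Q' where "Q' v w a = P' (D x v) (D x w) (D x a) + P (u x) (D2 v a) (D x w)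
    + P (u x) (D x v) (D2 w a)" for v w a
  have D: "(u has_derivative D y) (at y)" if "y \<in> S" for y
    using smooth_on_differentiable[OF u that] unfolding D_def by (simp add: frechet_derivative_works)
  have D2: "((\<lambda>y. D y v) has_derivative D2 v) (at x)" for v
    using smooth_on_differentiable[OF smooth_on_frechet_derivative[OF u S(1)] S(2), of v]
    unfolding D_def D2_def by (simp add: frechet_derivative_works)
  have sym: "D2 v w = D2 w v" for v w
    by (rule symmetric_second_derivative[OF S(1,2) D D2 D2])
  show "((\<lambda>y. P (u y) (frechet_derivative u (at y) v) (frechet_derivative u (at y) w))
       has_derivative Q' v w) (at x)" for v w
    using has_derivative_pullback_form[where D = D and E = D2, OF U S P' D[OF S(2)] D2, of v w]
    by (simp add: D_def[symmetric] Q'_def[abs_def])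
  show "Q' v w a + Q' w a v + Q' a v w = 0" for a v w
    using closed[of v w a] anti[of "D2 v a" "D x w"] anti[of "D2 w v" "D x a"] anti[of "D2 a w" "D x v"]
      sym[of v a] sym[of w v] sym[of a w]
    unfolding Q'_def Let_def D_def[symmetric] by simp
qed

section \<open>The fundamental 2-form of an almost contact metric manifold\<close>

text \<open>\<open>riemannian_metric\<close> grants linearity in the second argument only, and only
  on tangent vectors; the rules for the first argument come from symmetry, whence the membership
  premises.\<close>

lemma riemannian_metric_properties:
  assumes "smooth_manifold A" "riemannian_metric A g"
    and "u \<in> tangent_space A p" "v \<in> tangent_space A p"
  shows metric_sym: "g p u v = g p v u"
    and metric_add_right: "w \<in> tangent_space A p \<Longrightarrow> g p u (v + w) = g p u v + g p u w"
    and metric_scale_right: "g p u (a *\<^sub>R v) = a * g p u v"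
    and metric_add_left: "w \<in> tangent_space A p \<Longrightarrow> g p (v + w) u = g p v u + g p w u"
    and metric_scale_left: "g p (a *\<^sub>R v) u = a * g p v u"
    and metric_zero_right: "g p u 0 = 0"
    and metric_zero_left: "g p 0 u = 0"
    and metric_pos: "u \<noteq> 0 \<Longrightarrow> g p u u > 0"
proof -
  note T = subspace_tangent_space[OF assms(1), of p]
  have sym: "g p u v = g p v u" if "u \<in> tangent_space A p" "v \<in> tangent_space A p" for u v
    using assms(2) that unfolding riemannian_metric_def by blast
  have add: "g p u (v + w) = g p u v + g p u w"
    if "u \<in> tangent_space A p" "v \<in> tangent_space A p" "w \<in> tangent_space A p" for u v w
    using assms(2) that unfolding riemannian_metric_def linear_on_subspace_def by blast
  have scale: "g p u (a *\<^sub>R v) = a * g p u v"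
    if "u \<in> tangent_space A p" "v \<in> tangent_space A p" for u v a
    using assms(2) that unfolding riemannian_metric_def linear_on_subspace_def real_scaleR_def by blast
  show "g p u v = g p v u" by (rule sym[OF assms(3,4)])
  show "g p u (v + w) = g p u v + g p u w" "g p (v + w) u = g p v u + g p w u"
    if "w \<in> tangent_space A p"
    using add sym assms(3,4) that subspace_add[OF T] by metis+
  show "g p u (a *\<^sub>R v) = a * g p u v" "g p (a *\<^sub>R v) u = a * g p v u"
    using scale sym assms(3,4) subspace_scale[OF T] by metis+
  show "g p u 0 = 0" "g p 0 u = 0"
    using scale[OF assms(3,4), of 0] sym[OF assms(3) subspace_0[OF T]] by simp_all
  show "g p u u > 0" if "u \<noteq> 0"
    using assms(2,3) that unfolding riemannian_metric_def by blast
qed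

section \<open>Algebraic identities of an almost contact metric structure\<close>

context
  fixes n :: nat and N :: "('p::{t2_space,second_countable_topology}, 'e::euclidean_space) chart set"
    and \<phi> \<xi> \<eta> g
  assumes acm: "almost_contact_metric_manifold n N \<phi> \<xi> \<eta> g"
begin

lemma acm_manifold: "smooth_manifold N"
  and acm_metric: "riemannian_metric N g"
  and acm_tensor: "tensor_field_1_1 N \<phi>"
  using acm unfolding almost_contact_metric_manifold_def by blast+

lemma xi_in_tangent_space: "\<xi> p \<in> tangent_space N p"
  using acm unfolding almost_contact_metric_manifold_def vector_field_on_def by blast

lemma phi_in_tangent_space: "u \<in> tangent_space N p \<Longrightarrow> \<phi> p u \<in> tangent_space N p"
  using acm_tensor unfolding tensor_field_1_1_def by blast

lemma phi_add: "u \<in> tangent_space N p \<Longrightarrow> v \<in> tangent_space N p \<Longrightarrow> \<phi> p (u + v) = \<phi> p u + \<phi> p v"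
  and phi_scale: "u \<in> tangent_space N p \<Longrightarrow> \<phi> p (a *\<^sub>R u) = a *\<^sub>R \<phi> p u"
  using acm_tensor unfolding tensor_field_1_1_def linear_on_subspace_def by blast+

lemma eta_xi: "\<eta> p (\<xi> p) = 1"
  and phi_phi: "u \<in> tangent_space N p \<Longrightarrow> \<phi> p (\<phi> p u) = - u + \<eta> p u *\<^sub>R \<xi> p"
  and metric_phi_phi: "u \<in> tangent_space N p \<Longrightarrow> v \<in> tangent_space N p \<Longrightarrow>
    g p (\<phi> p u) (\<phi> p v) = g p u v - \<eta> p u * \<eta> p v"
  using acm unfolding almost_contact_metric_manifold_def by blast+

lemma xi_nonzero: "\<xi> p \<noteq> 0"
proof
  assume "\<xi> p = 0"
  moreover have "one_form N \<eta>"
    using acm unfolding almost_contact_metric_manifold_def by blast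
  then have "\<eta> p (0 *\<^sub>R \<xi> p) = 0 *\<^sub>R \<eta> p (\<xi> p)"
    using xi_in_tangent_space[of p] unfolding one_form_def linear_on_subspace_def by blast
  ultimately show False using eta_xi[of p] by simp
qed

text \<open>The square of \<phi> annihilates \<xi>, which forces \<phi> \<xi> to be a multiple of
  \<xi> whose coefficient squares to 0. Hence \<phi> \<xi> = 0, and computing the cube of \<phi> on
  \<open>u\<close> in two ways leaves only the \<eta>-term of \<open>\<phi> p u\<close>.\<close>

lemma eta_phi:
  assumes u: "u \<in> tangent_space N p"
  shows "\<eta> p (\<phi> p u) = 0"
proof -
  note T = subspace_tangent_space[OF acm_manifold, of p]
  note \<xi> = xi_in_tangent_space[of p]
  have zero: "\<phi> p 0 = 0" using phi_scale[OF u, of 0] by simp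
  have xi: "\<phi> p (\<phi> p (\<xi> p)) = 0"
    using phi_phi[OF \<xi>] eta_xi[of p] by simp
  have "\<phi> p (\<xi> p) = \<eta> p (\<phi> p (\<xi> p)) *\<^sub>R \<xi> p"
    using phi_phi[OF phi_in_tangent_space[OF \<xi>]] xi zero by simp
  then have "\<phi> p (\<phi> p (\<xi> p)) = (\<eta> p (\<phi> p (\<xi> p)) * \<eta> p (\<phi> p (\<xi> p))) *\<^sub>R \<xi> p"
    using phi_scale[OF \<xi>] by (metis scaleR_scaleR)
  then have phi_xi: "\<phi> p (\<xi> p) = 0"
    using xi xi_nonzero[of p] \<open>\<phi> p (\<xi> p) = _\<close> by (metis mult_eq_0_iff scaleR_eq_0_iff)
  have "\<phi> p (\<phi> p (\<phi> p u)) = \<phi> p ((-1) *\<^sub>R u + \<eta> p u *\<^sub>R \<xi> p)"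
    by (simp only: phi_phi[OF u] scaleR_minus1_left)
  also have "\<dots> = - \<phi> p u"
    unfolding phi_add[OF subspace_scale[OF T u] subspace_scale[OF T \<xi>]] phi_scale[OF u]
      phi_scale[OF \<xi>] phi_xi by simp
  finally have "\<eta> p (\<phi> p u) *\<^sub>R \<xi> p = 0"
    using phi_phi[OF phi_in_tangent_space[OF u]] by simp
  then show ?thesis using xi_nonzero[of p] by simp
qed

text \<open>Metric compatibility is applied twice, to the pair \<xi>, \<open>u\<close> and to its
  image under \<phi>. The doubly transformed product is 0 because the square of \<phi> annihilates
  \<xi>.\<close>

lemma eta_eq_metric_xi:
  assumes u: "u \<in> tangent_space N p"
  shows "\<eta> p u = g p (\<xi> p) u"
proof -
  note \<xi> = xi_in_tangent_space[of p] and M = acm_manifold acm_metric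
  have "g p (\<phi> p (\<phi> p (\<xi> p))) (\<phi> p (\<phi> p u)) = g p (\<phi> p (\<xi> p)) (\<phi> p u)"
    using metric_phi_phi[OF phi_in_tangent_space[OF \<xi>] phi_in_tangent_space[OF u]] eta_phi[OF u]
    by simp
  also have "\<dots> = g p (\<xi> p) u - \<eta> p u" using metric_phi_phi[OF \<xi> u] eta_xi by simp
  also have "\<phi> p (\<phi> p (\<xi> p)) = 0" using phi_phi[OF \<xi>] eta_xi[of p] by simp
  finally show ?thesis
    using metric_zero_left[OF M phi_in_tangent_space[OF phi_in_tangent_space[OF u]] \<xi>] by simp
qed

text \<open>Metric compatibility for \<open>u\<close> and \<open>\<phi> p v\<close> places the
  square of \<phi> on \<open>v\<close>; the resulting \<xi>-component is orthogonal to
  \<open>\<phi> p u\<close>, and the rest is \<open>- v\<close>.\<close>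

lemma metric_phi_right:
  assumes u: "u \<in> tangent_space N p" and v: "v \<in> tangent_space N p"
  shows "g p u (\<phi> p v) = - g p (\<phi> p u) v"
proof -
  note \<xi> = xi_in_tangent_space[of p] and M = acm_manifold acm_metric
  note T = subspace_tangent_space[OF acm_manifold, of p]
  note \<phi>u = phi_in_tangent_space[OF u] and \<phi>v = phi_in_tangent_space[OF v]
  have "g p u (\<phi> p v) = g p (\<phi> p u) (\<phi> p (\<phi> p v))"
    using metric_phi_phi[OF u \<phi>v] eta_phi[OF v] by simp
  also have "\<dots> = g p (\<phi> p u) ((-1) *\<^sub>R v + \<eta> p v *\<^sub>R \<xi> p)"
    by (simp only: phi_phi[OF v] scaleR_minus1_left)
  also have "\<dots> = - g p (\<phi> p u) v + \<eta> p v * g p (\<phi> p u) (\<xi> p)"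
    unfolding metric_add_right[OF M \<phi>u subspace_scale[OF T v] subspace_scale[OF T \<xi>]]
      metric_scale_right[OF M \<phi>u v] metric_scale_right[OF M \<phi>u \<xi>] by simp
  also have "g p (\<phi> p u) (\<xi> p) = 0"
    using eta_eq_metric_xi[OF \<phi>u] eta_phi[OF u] metric_sym[OF M \<phi>u \<xi>] by simp
  finally show ?thesis by simp
qed

lemma fundamental_form_antisym:
  assumes "u \<in> tangent_space N p" "v \<in> tangent_space N p"
  shows "g p u (\<phi> p v) = - g p v (\<phi> p u)"
  using metric_phi_right[OF assms] metric_sym[OF acm_manifold acm_metric phi_in_tangent_space] assms
  by simp

section \<open>Levi-Civita connection and closedness of the fundamental form\<close>

context
  fixes nabla
  assumes lc: "levi_civita N g nabla"
    and struct: "cosymplectic N nabla \<phi> \<or> sasakian N nabla \<phi> \<xi> \<eta> g \<or> kenmotsu N nabla \<phi> \<xi> \<eta> g"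
begin

text \<open>In all three cases \<open>(\<nabla>\<^sub>X \<phi>) Y\<close> is a multiple of \<open>\<xi>\<close> as soon as \<open>\<eta>(Y) = 0\<close>.\<close>
lemma metric_cov_deriv_phi:
  assumes W: "open W" "p \<in> W" and X: "vector_field_on N W X" and Y: "vector_field_on N W Y"
    and u: "u \<in> tangent_space N p" "\<eta> p u = 0" "\<eta> p (Y p) = 0"
  shows "g p u (cov_deriv_1_1 nabla \<phi> X Y p) = 0"
proof -
  have "\<exists>a. cov_deriv_1_1 nabla \<phi> X Y p = a *\<^sub>R \<xi> p"
    using struct
  proof (elim disjE)
    assume "cosymplectic N nabla \<phi>"
    then have "cov_deriv_1_1 nabla \<phi> X Y p = 0 *\<^sub>R \<xi> p"
      using W X Y unfolding cosymplectic_def by simp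
    then show ?thesis ..
  next
    assume "sasakian N nabla \<phi> \<xi> \<eta> g"
    then have "cov_deriv_1_1 nabla \<phi> X Y p = g p (X p) (Y p) *\<^sub>R \<xi> p"
      using W X Y u unfolding sasakian_def by simp
    then show ?thesis ..
  next
    assume "kenmotsu N nabla \<phi> \<xi> \<eta> g"
    then have "cov_deriv_1_1 nabla \<phi> X Y p = g p (\<phi> p (X p)) (Y p) *\<^sub>R \<xi> p"
      using W X Y u unfolding kenmotsu_def by simp
    then show ?thesis ..
  qed
  then obtain a where "cov_deriv_1_1 nabla \<phi> X Y p = a *\<^sub>R \<xi> p" ..
  moreover have "g p u (\<xi> p) = 0"
    using u eta_eq_metric_xi[OF u(1)]
      metric_sym[OF acm_manifold acm_metric u(1) xi_in_tangent_space] by simp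
  ultimately show ?thesis
    using metric_scale_right[OF acm_manifold acm_metric u(1) xi_in_tangent_space] by simp
qed

lemma connection_vector_field:
  assumes "open W" "vector_field_on N W X" "vector_field_on N W Y"
  shows "vector_field_on N W (nabla X Y)"
  using lc assms unfolding levi_civita_def affine_connection_def by blast

text \<open>Coordinate fields have constant components in their own chart, so their Lie bracket is 0
  and torsion-freeness gives the symmetry.\<close>

lemma connection_coord_vec_sym:
  assumes c: "c \<in> N" "p \<in> dom_chart c"
  shows "nabla (coord_vec N c s) (coord_vec N c t) p = nabla (coord_vec N c t) (coord_vec N c s) p"
proof -
  let ?W = "dom_chart c" and ?X = "coord_vec N c s" and ?Y = "coord_vec N c t"
  note A = acm_manifold
  note W = open_dom_chart[OF A c(1)]
  note X = vector_field_coord_vec[OF A c(1), of s] and Y = vector_field_coord_vec[OF A c(1), of t]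
  have T: "nabla ?X ?Y p \<in> tangent_space N p" "nabla ?Y ?X p \<in> tangent_space N p"
    using connection_vector_field[OF W X Y] connection_vector_field[OF W Y X] c
    unfolding vector_field_on_def by blast+
  have br: "nabla ?X ?Y p - nabla ?Y ?X p = lie_bracket N ?X ?Y p"
    using lc W X Y c unfolding levi_civita_def by blast
  have const: "frechet_derivative (\<lambda>x. components (coord_vec N c r (inv_coord c x)) c) (at (coord c p)) a = 0"
    for r a
  proof -
    have "frechet_derivative (\<lambda>x. r) (at (coord c p)) =
        frechet_derivative (\<lambda>x. components (coord_vec N c r (inv_coord c x)) c) (at (coord c p))"
      by (rule frechet_derivative_transform_within_open[OF _ open_coord_image[OF A c(1) open_UNIV]])
        (use A c components_coord_vec_self[OF A c(1)] inv_coord_in_dom[OF A c(1)] in auto)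
    then show ?thesis by (metis frechet_derivative_const)
  qed
  have "components (lie_bracket N ?X ?Y p) c = 0"
    using c const by (simp add: lie_bracket_def Tvec_inverse)
  then have "components (nabla ?X ?Y p) c = components (nabla ?Y ?X p) c"
    using br by (metis components_diff right_minus_eq)
  then show ?thesis by (rule tangent_space_eqI[OF T c])
qed

lemma fundamental_form_smooth:
  assumes c: "c \<in> N"
  shows "smooth_on (coord c ` dom_chart c) (\<lambda>z. g (inv_coord c z)
    (coord_vec N c s (inv_coord c z)) (\<phi> (inv_coord c z) (coord_vec N c t (inv_coord c z))))"
proof -
  note A = acm_manifold
  note W = open_dom_chart[OF A c]
  have X: "vector_field_on N (dom_chart c) (coord_vec N c s)" by (rule vector_field_coord_vec[OF A c])
  have "vector_field_on N (dom_chart c) (\<lambda>p. \<phi> p (coord_vec N c t p))"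
    using acm_tensor W vector_field_coord_vec[OF A c] unfolding tensor_field_1_1_def by blast
  with X W acm_metric
  have "smooth_fun_on N (dom_chart c) (\<lambda>p. g p (coord_vec N c s p) (\<phi> p (coord_vec N c t p)))"
    unfolding riemannian_metric_def by blast
  then have "smooth_on (coord c ` (dom_chart c \<inter> dom_chart c))
      ((\<lambda>p. g p (coord_vec N c s p) (\<phi> p (coord_vec N c t p))) \<circ> inv_coord c)"
    using c unfolding smooth_fun_on_def by blast
  then show ?thesis by (simp add: o_def)
qed

text \<open>The exterior derivative of the fundamental 2-form \<open>g(X, \<phi> Y)\<close> vanishes on the kernel of
  \<open>\<eta>\<close>. The chart is the one used by \<open>dir_deriv\<close>.\<close>
lemma fundamental_form_closed:
  fixes p
  defines "c \<equiv> chart_at N p"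
  defines "P \<equiv> \<lambda>s t z. g (inv_coord c z)
    (coord_vec N c s (inv_coord c z)) (\<phi> (inv_coord c z) (coord_vec N c t (inv_coord c z)))"
  assumes eta: "\<eta> p (coord_vec N c s p) = 0" "\<eta> p (coord_vec N c t p) = 0" "\<eta> p (coord_vec N c r p) = 0"
  shows "frechet_derivative (P s t) (at (coord c p)) r + frechet_derivative (P t r) (at (coord c p)) s
    + frechet_derivative (P r s) (at (coord c p)) t = 0"
proof -
  note A = acm_manifold and M = acm_manifold acm_metric
  have c: "c \<in> N" "p \<in> dom_chart c" unfolding c_def by (rule chart_at_in[OF A])+
  let ?W = "dom_chart c"
  note W = open_dom_chart[OF A c(1)]
  let ?X = "coord_vec N c"
  note X = vector_field_coord_vec[OF A c(1)]
  have \<phi>X: "vector_field_on N ?W (\<lambda>p. \<phi> p (?X t p))" for t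
    using acm_tensor W X unfolding tensor_field_1_1_def by blast
  note T = coord_vec_in_tangent_space[OF A c]
  have nT: "nabla (?X s) (?X t) p \<in> tangent_space N p" for s t
    using connection_vector_field[OF W X X] c unfolding vector_field_on_def by blast
  \<comment> \<open>Metric compatibility, followed by the Leibniz rule for \<phi>. The term with the
    covariant derivative of \<phi> drops out because both remaining arguments lie in the kernel of
    \<eta>; skew-symmetry of \<phi> rewrites the last term.\<close>
  have *: "frechet_derivative (P t r) (at (coord c p)) s =
      g p (nabla (?X s) (?X t) p) (\<phi> p (?X r p)) - g p (\<phi> p (?X t p)) (nabla (?X s) (?X r) p)"
    if eta: "\<eta> p (?X t p) = 0" "\<eta> p (?X r p) = 0" for s t r
  proof -
    have n\<phi>T: "nabla (?X s) (\<lambda>p. \<phi> p (?X r p)) p \<in> tangent_space N p"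
      using connection_vector_field[OF W X \<phi>X] c unfolding vector_field_on_def by blast
    have "frechet_derivative (P t r) (at (coord c p)) s =
        dir_deriv N p (?X s p) (\<lambda>q. g q (?X t q) (\<phi> q (?X r q)))"
      unfolding dir_deriv_def Let_def c_def[symmetric] components_coord_vec_self[OF A c] P_def o_def ..
    also have "\<dots> = g p (nabla (?X s) (?X t) p) (\<phi> p (?X r p)) +
        g p (?X t p) (nabla (?X s) (\<lambda>p. \<phi> p (?X r p)) p)"
      using lc W X[of s] X[of t] \<phi>X[of r] c unfolding levi_civita_def by blast
    also have "nabla (?X s) (\<lambda>p. \<phi> p (?X r p)) p =
        cov_deriv_1_1 nabla \<phi> (?X s) (?X r) p + \<phi> p (nabla (?X s) (?X r) p)"
      by (simp add: cov_deriv_1_1_def)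
    also have "g p (?X t p) \<dots> = g p (?X t p) (cov_deriv_1_1 nabla \<phi> (?X s) (?X r) p) +
        g p (?X t p) (\<phi> p (nabla (?X s) (?X r) p))"
    proof (rule metric_add_right[OF M T])
      show "cov_deriv_1_1 nabla \<phi> (?X s) (?X r) p \<in> tangent_space N p"
        unfolding cov_deriv_1_1_def
        by (rule subspace_diff[OF subspace_tangent_space[OF A] n\<phi>T phi_in_tangent_space[OF nT]])
    qed (rule phi_in_tangent_space[OF nT])
    also have "g p (?X t p) (cov_deriv_1_1 nabla \<phi> (?X s) (?X r) p) = 0"
      by (rule metric_cov_deriv_phi[OF W c(2) X X T eta])
    also have "g p (?X t p) (\<phi> p (nabla (?X s) (?X r) p)) = - g p (\<phi> p (?X t p)) (nabla (?X s) (?X r) p)"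
      by (rule metric_phi_right[OF T nT])
    finally show ?thesis by simp
  qed
  \<comment> \<open>With the symmetry of the connection, the six terms of the cyclic sum cancel in
    pairs.\<close>
  have swap: "g p (\<phi> p (?X t p)) (nabla (?X s) (?X r) p) = g p (nabla (?X r) (?X s) p) (\<phi> p (?X t p))"
    for s t r
    using metric_sym[OF M phi_in_tangent_space[OF T] nT] connection_coord_vec_sym[OF c] by metis
  show ?thesis
    using *[of t r s] *[of r s t] *[of s t r] eta swap by simp
qed

text \<open>Normality of \<xi> puts the image of the differential at \<open>p\<close> into the
  kernel of \<eta>, where the fundamental form is closed. \<open>Q'\<close> is the derivative of the
  coefficients of the pulled-back form, and its cyclic identity is closedness at
  \<open>p\<close>.\<close>

lemma pullback_fundamental_form_closed:
  fixes M :: "('m::{t2_space,second_countable_topology}, 'k::euclidean_space) chart set"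
  assumes M: "smooth_manifold M" and F: "smooth_map M N F"
    and d: "d \<in> M" "p \<in> dom_chart d"
    and normal: "\<And>v. v \<in> tangent_space M p \<Longrightarrow> g (F p) (\<xi> (F p)) (differential M N F p v) = 0"
  obtains Q' where
    "\<And>v w. ((\<lambda>x. let q = inv_coord d x in g (F q) (differential M N F q (coord_vec M d v q))
        (\<phi> (F q) (differential M N F q (coord_vec M d w q)))) has_derivative Q' v w) (at (coord d p))"
    "\<And>a v w. Q' v w a + Q' w a v + Q' a v w = 0"
proof -
  note A = acm_manifold
  \<comment> \<open>\<open>fundamental_form_closed\<close> is available in this particular chart of
    \<open>N\<close>; the chart \<open>d\<close> of \<open>M\<close> stays arbitrary, so that a
    product chart can be inserted later.\<close>
  define c where "c = chart_at N (F p)"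
  have c: "c \<in> N" "F p \<in> dom_chart c" unfolding c_def by (rule chart_at_in[OF A])+
  define P where "P z s t = g (inv_coord c z)
    (coord_vec N c s (inv_coord c z)) (\<phi> (inv_coord c z) (coord_vec N c t (inv_coord c z)))" for z s t
  define u where "u = coord c \<circ> F \<circ> inv_coord d"
  define S where "S = coord d ` (dom_chart d \<inter> F -` dom_chart c)"
  let ?U = "coord c ` dom_chart c"
  have U: "open ?U" using open_coord_image[OF A c(1) open_UNIV] by simp
  have S: "open S" "coord d p \<in> S"
    unfolding S_def using open_transition_domain[OF M A F d(1) c(1)] d c by auto
  have uS: "u ` S \<subseteq> ?U" unfolding u_def S_def using M d by auto
  have u: "smooth_on S u" unfolding u_def S_def by (rule smooth_map_transition[OF F d(1) c(1)])
  have up: "u (coord d p) = coord c (F p)" unfolding u_def using M d by simp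
  have bil: "bilinear (P z)" if "z \<in> ?U" for z
  proof -
    define q where "q = inv_coord c z"
    have q: "q \<in> dom_chart c" unfolding q_def by (rule inv_coord_in_dom[OF A c(1) that])
    note T = coord_vec_in_tangent_space[OF A c(1) q]
    note lin = linear_coord_vec[OF A c(1) q]
    show ?thesis
      unfolding bilinear_def P_def q_def[symmetric]
      by (auto intro!: linearI simp: linear_add[OF lin] linear_scale[OF lin] phi_add[OF T T]
          phi_scale[OF T] metric_add_right[OF A acm_metric T phi_in_tangent_space[OF T] phi_in_tangent_space[OF T]]
          metric_scale_right[OF A acm_metric T phi_in_tangent_space[OF T]]
          metric_add_left[OF A acm_metric phi_in_tangent_space[OF T] T T]
          metric_scale_left[OF A acm_metric phi_in_tangent_space[OF T] T])
  qed
  have P': "((\<lambda>z. P z s t) has_derivative frechet_derivative (\<lambda>z. P z s t) (at (u (coord d p))))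
      (at (u (coord d p)))" for s t
    unfolding frechet_derivative_works[symmetric] P_def up
    by (rule smooth_on_differentiable[OF fundamental_form_smooth[OF c(1)]]) (use c in blast)
  have anti: "P (u (coord d p)) s t = - P (u (coord d p)) t s" for s t
    unfolding P_def up inv_coord_coord[OF A c]
    by (rule fundamental_form_antisym[OF coord_vec_in_tangent_space[OF A c] coord_vec_in_tangent_space[OF A c]])
  have dF: "differential M N F q (coord_vec M d v q) = coord_vec N c (frechet_derivative u (at (coord d q)) v) (F q)"
    if "q \<in> dom_chart d" "F q \<in> dom_chart c" for q v
    unfolding u_def by (rule differential_coord_vec[OF M A F d(1) that(1) c(1) that(2)])
  have eta: "\<eta> (F p) (coord_vec N c (frechet_derivative u (at (coord d p)) v) (F p)) = 0" for v
    using normal[OF coord_vec_in_tangent_space[OF M d]] dF[OF d(2) c(2)]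
      eta_eq_metric_xi[OF coord_vec_in_tangent_space[OF A c]] by simp
  have closed: "let D = frechet_derivative u (at (coord d p)) in
      frechet_derivative (\<lambda>z. P z (D v) (D w)) (at (u (coord d p))) (D a)
      + frechet_derivative (\<lambda>z. P z (D w) (D a)) (at (u (coord d p))) (D v)
      + frechet_derivative (\<lambda>z. P z (D a) (D v)) (at (u (coord d p))) (D w) = 0" for a v w
    using fundamental_form_closed[of "F p", folded c_def, OF eta eta eta, of v w a]
    unfolding Let_def P_def up by simp
  obtain Q' where Q': "\<And>v w. ((\<lambda>y. P (u y) (frechet_derivative u (at y) v) (frechet_derivative u (at y) w))
       has_derivative Q' v w) (at (coord d p))" "\<And>a v w. Q' v w a + Q' w a v + Q' a v w = 0"
    using pullback_closed_form[OF U bil S uS u P' anti closed] by blast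
  show ?thesis
  proof (rule that[OF _ Q'(2)])
    fix v w
    show "((\<lambda>x. let q = inv_coord d x in g (F q) (differential M N F q (coord_vec M d v q))
        (\<phi> (F q) (differential M N F q (coord_vec M d w q)))) has_derivative Q' v w) (at (coord d p))"
    proof (rule has_derivative_transform_within_open[OF Q'(1) S])
      fix x assume "x \<in> S"
      then obtain q where q: "q \<in> dom_chart d" "F q \<in> dom_chart c" "x = coord d q"
        unfolding S_def by auto
      have x: "inv_coord d x = q" using M d q by simp
      have ux: "inv_coord c (u x) = F q" unfolding u_def using A c q x by simp
      show "P (u x) (frechet_derivative u (at x) v) (frechet_derivative u (at x) w) =
        (let q = inv_coord d x in g (F q) (differential M N F q (coord_vec M d v q))
          (\<phi> (F q) (differential M N F q (coord_vec M d w q))))"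
        unfolding Let_def P_def ux x dF[OF q(1,2)] by (simp add: q(3))
    qed
  qed
qed

end

end

section \<open>Warped products\<close>

lemma smooth_map_const:
  fixes A :: "('p::topological_space, 'e::euclidean_space) chart set"
    and A' :: "('q::topological_space, 'd::euclidean_space) chart set"
  shows "smooth_map A A' (\<lambda>x. q)"
  unfolding smooth_map_def by (auto simp: o_def smooth_on_const continuous_on_const)

section \<open>Orthogonal splitting of the warped product metric\<close>

context
  fixes B :: "('b::{t2_space,second_countable_topology}, 'k::euclidean_space) chart set"
    and F :: "('f::{t2_space,second_countable_topology}, 'l::euclidean_space) chart set"
  assumes B: "smooth_manifold B" and F: "smooth_manifold F"
begin

abbreviation (input) "lift_first b y \<equiv> differential B (prod_atlas B F) (\<lambda>x. (x, y)) b"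
abbreviation (input) "lift_second b y \<equiv> differential F (prod_atlas B F) (\<lambda>y. (b, y)) y"

lemma lift_first_in_tangent_space:
  "v \<in> tangent_space B b \<Longrightarrow> lift_first b y v \<in> tangent_space (prod_atlas B F) (b, y)"
  by (rule differential_in_tangent_space[OF B smooth_manifold_prod_atlas[OF B F] smooth_map_Pair_left[OF B F]])

lemma lift_second_in_tangent_space:
  "v \<in> tangent_space F y \<Longrightarrow> lift_second b y v \<in> tangent_space (prod_atlas B F) (b, y)"
  by (rule differential_in_tangent_space[OF F smooth_manifold_prod_atlas[OF B F] smooth_map_Pair_right[OF B F]])

lemma differential_fst_lift_second:
  assumes "v \<in> tangent_space F y"
  shows "differential (prod_atlas B F) B fst (b, y) (lift_second b y v) = 0"
  using differential_compose[OF F smooth_manifold_prod_atlas[OF B F] B smooth_map_Pair_right[OF B F]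
      smooth_map_fst[OF B F] _ assms, of b] smooth_map_const[of F B b]
  by (simp add: o_def differential_const)

lemma differential_snd_lift_first:
  assumes "v \<in> tangent_space B b"
  shows "differential (prod_atlas B F) F snd (b, y) (lift_first b y v) = 0"
  using differential_compose[OF B smooth_manifold_prod_atlas[OF B F] F smooth_map_Pair_left[OF B F]
      smooth_map_snd[OF B F] _ assms, of y] smooth_map_const[of B F y]
  by (simp add: o_def differential_const)

lemma differential_snd_lift_second:
  assumes "v \<in> tangent_space F y"
  shows "differential (prod_atlas B F) F snd (b, y) (lift_second b y v) = v"
  using differential_compose[OF F smooth_manifold_prod_atlas[OF B F] F smooth_map_Pair_right[OF B F]
      smooth_map_snd[OF B F] _ assms, of b] smooth_map_id[OF F] differential_id[OF F assms]
  by (simp add: o_def id_def)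

lemma warped_product_metric_second:
  assumes gB: "riemannian_metric B gB"
    and v: "v \<in> tangent_space F y" and w: "w \<in> tangent_space F y"
  shows "warped_product_metric B gB f F gF (b, y) (lift_second b y v) (lift_second b y w) =
    (f b)\<^sup>2 * gF y v w"
  using metric_zero_right[OF B gB subspace_0[OF subspace_tangent_space[OF B]]
      subspace_0[OF subspace_tangent_space[OF B]]]
  by (simp add: warped_product_metric_def differential_fst_lift_second[OF v]
      differential_fst_lift_second[OF w] differential_snd_lift_second[OF v]
      differential_snd_lift_second[OF w])

text \<open>Each summand has a zero argument: \<open>fst\<close> is constant along copies of the
  second factor, and \<open>snd\<close> along copies of the first.\<close>

lemma warped_product_metric_mixed:
  assumes gB: "riemannian_metric B gB" and gF: "riemannian_metric F gF"
    and v: "v \<in> tangent_space B b" and w: "w \<in> tangent_space F y"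
  shows "warped_product_metric B gB f F gF (b, y) (lift_first b y v) (lift_second b y w) = 0"
proof -
  have "differential (prod_atlas B F) B fst (b, y) (lift_first b y v) \<in> tangent_space B b"
    using differential_in_tangent_space[OF smooth_manifold_prod_atlas[OF B F] B smooth_map_fst[OF B F]
        lift_first_in_tangent_space[OF v]] by simp
  from metric_zero_right[OF B gB this this] metric_zero_left[OF F gF w w] show ?thesis
    by (simp add: warped_product_metric_def differential_fst_lift_second[OF w]
        differential_snd_lift_second[OF w] differential_snd_lift_first[OF v])
qed

end

text \<open>\<open>T\<close> is a coordinate ball, hence convex in coordinates. It is chosen before
  \<open>h\<close> and serves all functions at once; this matters because later the function tested
  depends on the point \<open>q\<close> at which it is compared.\<close>

lemma chart_derivative_zero_imp_locally_constant:
  fixes A :: "('p::{t2_space,second_countable_topology}, 'e::euclidean_space) chart set"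
  assumes A: "smooth_manifold A"
  obtains T where "open T" "p \<in> T"
    "\<And>(h :: 'p \<Rightarrow> real) q. (\<And>c q. c \<in> A \<Longrightarrow> q \<in> dom_chart c \<Longrightarrow>
       ((h \<circ> inv_coord c) has_derivative (\<lambda>_. 0)) (at (coord c q))) \<Longrightarrow>
       q \<in> T \<Longrightarrow> h q = h p"
proof -
  obtain c where c: "c \<in> A" "p \<in> dom_chart c" by (rule chart_exists[OF A])
  have "open (coord c ` dom_chart c)" using open_coord_image[OF A c(1) open_UNIV] by simp
  then obtain r where r: "r > 0" "ball (coord c p) r \<subseteq> coord c ` dom_chart c"
    using c openE by blast
  define T where "T = dom_chart c \<inter> coord c -` ball (coord c p) r"
  have "continuous_on (dom_chart c) (coord c)"
    using chart_homeomorphism[OF A c(1)] unfolding homeomorphism_def by blast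
  then have "open T"
    unfolding T_def by (intro continuous_open_preimage open_dom_chart[OF A c(1)] open_ball)
  moreover have "p \<in> T" using c r by (simp add: T_def)
  moreover have "h q = h p"
    if h: "\<And>c q. c \<in> A \<Longrightarrow> q \<in> dom_chart c \<Longrightarrow>
       ((h \<circ> inv_coord c) has_derivative (\<lambda>_. 0)) (at (coord c q))"
      and q: "q \<in> T" for h :: "'p \<Rightarrow> real" and q
  proof -
    have "(h \<circ> inv_coord c) (coord c q) = (h \<circ> inv_coord c) (coord c p)"
    proof (rule Derivative.has_derivative_zero_unique[where f = "h \<circ> inv_coord c", OF convex_ball])
      show "((h \<circ> inv_coord c) has_derivative (\<lambda>_. 0)) (at x within ball (coord c p) r)"
        if "x \<in> ball (coord c p) r" for x
      proof -
        have "x \<in> coord c ` dom_chart c" using that r(2) by (rule subsetD[rotated])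
        then obtain q where "q \<in> dom_chart c" "x = coord c q" by blast
        with h[OF c(1), of q] show ?thesis by (simp add: has_derivative_at_withinI)
      qed
    qed (use q r in \<open>auto simp: T_def\<close>)
    then show ?thesis using A c q by (simp add: T_def)
  qed
  ultimately show ?thesis using that by blast
qed

section \<open>Rigidity of the warping function over a \<open>\<phi>\<close>-invariant fibre\<close>

theorem theorem9p1:
  fixes N :: "('p::{t2_space,second_countable_topology}, 'e::euclidean_space) chart set"
    and n :: nat
    and \<phi> :: "'p \<Rightarrow> ('p, 'e) tvec \<Rightarrow> ('p, 'e) tvec"
    and \<xi> :: "'p \<Rightarrow> ('p, 'e) tvec"
    and \<eta> :: "'p \<Rightarrow> ('p, 'e) tvec \<Rightarrow> real"
    and g :: "('p, 'e) metric_tensor"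
    and nabla :: "('p, 'e) connection"
    and B :: "('b::{t2_space,second_countable_topology}, 'k::euclidean_space) chart set"
    and gB :: "('b, 'k) metric_tensor"
    and F :: "('f::{t2_space,second_countable_topology}, 'l::euclidean_space) chart set"
    and gF :: "('f, 'l) metric_tensor"
    and f :: "'b \<Rightarrow> real"
    and \<iota> :: "'b \<times> 'f \<Rightarrow> 'p"
  assumes "almost_contact_metric_manifold n N \<phi> \<xi> \<eta> g"
    and "levi_civita N g nabla"
    and "connected (UNIV :: 'b set)"
    and "warped_product_submanifold N g B gB f F gF \<iota>"
    and "\<not> f constant_on UNIV"
    and "normal_to_submanifold N g (prod_atlas B F) \<iota> \<xi>"
    and "cosymplectic N nabla \<phi> \<or> sasakian N nabla \<phi> \<xi> \<eta> g \<or> kenmotsu N nabla \<phi> \<xi> \<eta> g"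
  shows "\<not> (\<exists>D1 D2 \<theta>. proper_pointwise_semi_slant N \<phi> g (prod_atlas B F) \<iota> D1 D2 \<theta> \<and>
               D1 = tangent_second B F \<and> D2 = tangent_first B F)"
proof
  assume "\<exists>D1 D2 \<theta>. proper_pointwise_semi_slant N \<phi> g (prod_atlas B F) \<iota> D1 D2 \<theta> \<and>
               D1 = tangent_second B F \<and> D2 = tangent_first B F"
  then have invariant: "\<phi> (\<iota> p) ` differential (prod_atlas B F) N \<iota> p ` tangent_second B F p
      \<subseteq> differential (prod_atlas B F) N \<iota> p ` tangent_second B F p" for p
    unfolding proper_pointwise_semi_slant_def pointwise_semi_slant_def by blast
  note acm = assms(1)
  note N = acm_manifold[OF acm] and g = acm_metric[OF acm]
  have B: "smooth_manifold B" and F: "smooth_manifold F" and f: "\<And>b. f b > 0"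
    and gB: "riemannian_metric B gB" and gF: "riemannian_metric F gF"
    and \<iota>: "smooth_map (prod_atlas B F) N \<iota>"
    using assms(4) unfolding warped_product_submanifold_def immersion_def by blast+
  let ?M = "prod_atlas B F" and ?d = "differential (prod_atlas B F) N \<iota>"
  have M: "smooth_manifold ?M" by (rule smooth_manifold_prod_atlas[OF B F])
  have induced: "g (\<iota> p) (?d p u) (?d p v) = warped_product_metric B gB f F gF p u v"
    if "u \<in> tangent_space ?M p" "v \<in> tangent_space ?M p" for p u v
    using assms(4) that unfolding warped_product_submanifold_def induced_metric_def by blast
  have normal: "g (\<iota> p) (\<xi> (\<iota> p)) (?d p v) = 0" if "v \<in> tangent_space ?M p" for p v
    using assms(6) that unfolding normal_to_submanifold_def by blast
  define i where "i b y = differential B ?M (\<lambda>x. (x, y)) b" for b y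
  define j where "j b y = differential F ?M (\<lambda>y. (b, y)) y" for b y
  have iT: "i b y v \<in> tangent_space ?M (b, y)" if "v \<in> tangent_space B b" for b y v
    unfolding i_def by (rule lift_first_in_tangent_space[OF B F that])
  have jT: "j b y v \<in> tangent_space ?M (b, y)" if "v \<in> tangent_space F y" for b y v
    unfolding j_def by (rule lift_second_in_tangent_space[OF B F that])
  have dT: "?d p v \<in> tangent_space N (\<iota> p)" if "v \<in> tangent_space ?M p" for p v
    by (rule differential_in_tangent_space[OF M N \<iota> that])
  have gjj: "g (\<iota> (b, y)) (?d (b, y) (j b y v)) (?d (b, y) (j b y w)) = (f b)\<^sup>2 * gF y v w"
    if "v \<in> tangent_space F y" "w \<in> tangent_space F y" for b y v w
    unfolding induced[OF jT[OF that(1)] jT[OF that(2)]] unfolding j_def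
    by (rule warped_product_metric_second[OF B F gB that])
  have gij: "g (\<iota> (b, y)) (?d (b, y) (i b y v)) (?d (b, y) (j b y w)) = 0"
    if "v \<in> tangent_space B b" "w \<in> tangent_space F y" for b y v w
    unfolding induced[OF iT[OF that(1)] jT[OF that(2)]] unfolding i_def j_def
    by (rule warped_product_metric_mixed[OF B F gB gF that])
  have J_ex: "\<exists>w'. w' \<in> tangent_space F y \<and> \<phi> (\<iota> (b, y)) (?d (b, y) (j b y w)) = ?d (b, y) (j b y w')"
    if "w \<in> tangent_space F y" for b y w
  proof -
    have "j b y w \<in> tangent_second B F (b, y)" using that unfolding tangent_second_def j_def by simp
    then have "\<phi> (\<iota> (b, y)) (?d (b, y) (j b y w)) \<in> ?d (b, y) ` tangent_second B F (b, y)"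
      using invariant[of "(b, y)"] by blast
    then show ?thesis unfolding tangent_second_def j_def by auto
  qed
  \<comment> \<open>\<open>J b y\<close> is \<phi> at \<open>(b, y)\<close> transported to
    \<open>tangent_space F y\<close>, a space independent of \<open>b\<close>; only there can the
    structures over different points of \<open>B\<close> be compared.\<close>
  define J where "J b y w = (SOME w'. w' \<in> tangent_space F y \<and>
    \<phi> (\<iota> (b, y)) (?d (b, y) (j b y w)) = ?d (b, y) (j b y w'))" for b y w
  have JT: "J b y w \<in> tangent_space F y"
    and J: "\<phi> (\<iota> (b, y)) (?d (b, y) (j b y w)) = ?d (b, y) (j b y (J b y w))"
    if "w \<in> tangent_space F y" for b y w
    using someI_ex[OF J_ex[OF that, of b]] unfolding J_def[of b y w] by blast+
  \<comment> \<open>On vectors orthogonal to \<xi> the tensor \<phi> preserves \<open>g\<close>, and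
    both sides carry the same positive factor \<open>(f b)\<^sup>2\<close>, which cancels.\<close>
  have J_isometry: "gF y (J b y w) (J b y w) = gF y w w" if w: "w \<in> tangent_space F y" for b y w
  proof -
    note T = dT[OF jT[OF w]]
    have "\<eta> (\<iota> (b, y)) (?d (b, y) (j b y w)) = 0"
      using eta_eq_metric_xi[OF acm T] normal[OF jT[OF w]] by simp
    then have "(f b)\<^sup>2 * gF y (J b y w) (J b y w) = (f b)\<^sup>2 * gF y w w"
      using metric_phi_phi[OF acm T T] unfolding J[OF w] gjj[OF JT[OF w] JT[OF w]] gjj[OF w w] by simp
    then show ?thesis using f[of b] by simp
  qed
  have fund_ij: "g (\<iota> (b, y)) (?d (b, y) (i b y v)) (\<phi> (\<iota> (b, y)) (?d (b, y) (j b y w))) = 0"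
    if v: "v \<in> tangent_space B b" and w: "w \<in> tangent_space F y" for b y v w
    unfolding J[OF w] by (rule gij[OF v JT[OF w]])
  \<comment> \<open>The image under \<phi> of a vector along \<open>B\<close> need not be tangent to
    the submanifold, so orthogonality of the factors does not apply directly; antisymmetry reduces
    this case to \<open>fund_ij\<close>.\<close>
  have fund_ji: "g (\<iota> (b, y)) (?d (b, y) (j b y w)) (\<phi> (\<iota> (b, y)) (?d (b, y) (i b y v))) = 0"
    if v: "v \<in> tangent_space B b" and w: "w \<in> tangent_space F y" for b y v w
    using fundamental_form_antisym[OF acm dT[OF jT[OF w]] dT[OF iT[OF v]]] fund_ij[OF v w] by simp
  define h where "h y v w b = g (\<iota> (b, y)) (?d (b, y) (j b y v)) (\<phi> (\<iota> (b, y)) (?d (b, y) (j b y w)))"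
    for y v w b
  have h': "((h y v w \<circ> inv_coord c) has_derivative (\<lambda>_. 0)) (at (coord c b))"
    if c: "c \<in> B" "b \<in> dom_chart c" and v: "v \<in> tangent_space F y" and w: "w \<in> tangent_space F y"
    for y v w c b
  proof -
    define c' where "c' = chart_at F y"
    have c': "c' \<in> F" "y \<in> dom_chart c'" unfolding c'_def by (rule chart_at_in[OF F])+
    define C where "C = prod_chart c c'"
    have C: "C \<in> ?M" "(b, y) \<in> dom_chart C"
      using c c' unfolding prod_atlas_eq C_def by (blast, simp)
    define Q where "Q s t x = (let q = inv_coord C x in
      g (\<iota> q) (?d q (coord_vec ?M C s q)) (\<phi> (\<iota> q) (?d q (coord_vec ?M C t q))))" for s t x
    obtain Q' where Q': "\<And>s t. (Q s t has_derivative Q' s t) (at (coord C (b, y)))"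
      and closed: "\<And>a s t. Q' s t a + Q' t a s + Q' a s t = 0"
      using pullback_fundamental_form_closed[OF acm assms(2,7) M \<iota> C normal]
      unfolding Q_def[symmetric, abs_def] by blast
    have vec_left: "coord_vec ?M C (s, 0) (b, y) = i b y (coord_vec B c s b)"
      if "b \<in> dom_chart c" "y \<in> dom_chart c'" for s b y
      unfolding C_def i_def by (rule coord_vec_prod_left[OF B c(1) that(1) F c'(1) that(2)])
    have vec_right: "coord_vec ?M C (0, s) (b, y) = j b y (coord_vec F c' s y)"
      if "b \<in> dom_chart c" "y \<in> dom_chart c'" for s b y
      unfolding C_def j_def by (rule coord_vec_prod_right[OF B c(1) that(1) F c'(1) that(2)])
    have open_C: "open (coord C ` dom_chart C)" "coord C (b, y) \<in> coord C ` dom_chart C"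
      using open_coord_image[OF M C(1) open_UNIV] C by auto
    \<comment> \<open>Vanishing is required on the full chart image, since a zero value at one point
      says nothing about the derivative.\<close>
    have zero: "Q' s t = (\<lambda>_. 0)" if "\<And>x. x \<in> coord C ` dom_chart C \<Longrightarrow> Q s t x = 0" for s t
    proof (rule has_derivative_unique[OF Q'])
      show "(Q s t has_derivative (\<lambda>_. 0)) (at (coord C (b, y)))"
        by (rule has_derivative_transform_within_open[OF has_derivative_const[of 0] open_C])
          (simp add: that)
    qed
    have point: "\<exists>b y. inv_coord C x = (b, y) \<and> b \<in> dom_chart c \<and> y \<in> dom_chart c'"
      if "x \<in> coord C ` dom_chart C" for x
      using inv_coord_in_dom[OF M C(1) that] unfolding C_def by auto
    have Q1: "Q' (s, 0) (0, t) = (\<lambda>_. 0)" for s t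
    proof (rule zero)
      fix x assume "x \<in> coord C ` dom_chart C"
      then obtain b y where x: "inv_coord C x = (b, y)" "b \<in> dom_chart c" "y \<in> dom_chart c'"
        using point by blast
      show "Q (s, 0) (0, t) x = 0"
        unfolding Q_def Let_def x(1) vec_left[OF x(2,3)] vec_right[OF x(2,3)]
        by (intro fund_ij coord_vec_in_tangent_space B F c(1) c'(1) x)
    qed
    have Q2: "Q' (0, t) (s, 0) = (\<lambda>_. 0)" for s t
    proof (rule zero)
      fix x assume "x \<in> coord C ` dom_chart C"
      then obtain b y where x: "inv_coord C x = (b, y)" "b \<in> dom_chart c" "y \<in> dom_chart c'"
        using point by blast
      show "Q (0, t) (s, 0) x = 0"
        unfolding Q_def Let_def x(1) vec_left[OF x(2,3)] vec_right[OF x(2,3)]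
        by (intro fund_ji coord_vec_in_tangent_space B F c(1) c'(1) x)
    qed
    \<comment> \<open>In the cyclic identity for two fibre directions and one base direction, the
      two companion terms are derivatives of mixed coefficients.\<close>
    have Q3: "Q' (0, s) (0, t) (a, 0) = 0" for s t a
      using closed[of "(0, s)" "(0, t)" "(a, 0)"] unfolding Q1 Q2 by simp
    \<comment> \<open>For fixed \<open>y\<close>, the constant coefficients \<open>s\<close> and
      \<open>t\<close> represent \<open>j b y v\<close> and \<open>j b y w\<close> at every
      \<open>b\<close> in the chart, so \<open>Q\<close> along the slice is \<open>h y v w\<close>
      in coordinates.\<close>
    define s t where "s = components v c'" and "t = components w c'"
    have pair: "((\<lambda>x. (x, coord c' y)) has_derivative (\<lambda>a. (a, 0))) (at (coord c b))"
      by (auto intro!: derivative_eq_intros)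
    have "((\<lambda>x. Q (0, s) (0, t) (x, coord c' y)) has_derivative (\<lambda>a. Q' (0, s) (0, t) (a, 0))) (at (coord c b))"
      by (rule has_derivative_compose[OF pair]) (use Q' in \<open>simp add: C_def\<close>)
    then have "((\<lambda>x. Q (0, s) (0, t) (x, coord c' y)) has_derivative (\<lambda>_. 0)) (at (coord c b))"
      unfolding Q3 .
    then show ?thesis
    proof (rule has_derivative_transform_within_open)
      show "open (coord c ` (dom_chart c \<inter> UNIV))" by (rule open_coord_image[OF B c(1) open_UNIV])
      show "coord c b \<in> coord c ` (dom_chart c \<inter> UNIV)" using c by simp
      fix x assume "x \<in> coord c ` (dom_chart c \<inter> UNIV)"
      then obtain b where b: "b \<in> dom_chart c" "x = coord c b" by auto
      have x: "inv_coord c x = b" using B c b by simp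
      have q: "inv_coord C (x, coord c' y) = (b, y)"
        using inv_coord_prod_chart[OF B c(1) F c'(1), of x "coord c' y"] b c' F x
        unfolding C_def by simp
      show "Q (0, s) (0, t) (x, coord c' y) = (h y v w \<circ> inv_coord c) x"
        unfolding comp_apply x h_def Q_def q Let_def vec_right[OF b(1) c'(2)] s_def t_def
          coord_vec_components[OF F c' v] coord_vec_components[OF F c' w] ..
    qed
  qed
  obtain y :: 'f where True by blast
  obtain c' where c': "c' \<in> F" "y \<in> dom_chart c'" by (rule chart_exists[OF F])
  \<comment> \<open>A Euclidean space has a nonempty basis, so the fibre has a nonzero tangent
    vector. One \<open>y\<close> and one \<open>w\<close> serve for all points of
    \<open>B\<close>.\<close>
  define w where "w = coord_vec F c' (SOME e. e \<in> Basis) y"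
  have w: "w \<in> tangent_space F y" unfolding w_def by (rule coord_vec_in_tangent_space[OF F c'])
  have "components w c' \<in> Basis"
    unfolding w_def components_coord_vec_self[OF F c'] by (rule someI_ex) (use nonempty_Basis in blast)
  then have "w \<noteq> 0" using nonzero_Basis by force
  then have ww: "gF y w w > 0" by (rule metric_pos[OF F gF w w])
  have "f constant_on UNIV"
  proof (rule locally_constant_imp_constant[OF assms(3)])
    fix a :: 'b
    obtain T where T: "open T" "a \<in> T"
      "\<And>(h :: 'b \<Rightarrow> real) q. (\<And>c q. c \<in> B \<Longrightarrow> q \<in> dom_chart c \<Longrightarrow>
         ((h \<circ> inv_coord c) has_derivative (\<lambda>_. 0)) (at (coord c q))) \<Longrightarrow>
         q \<in> T \<Longrightarrow> h q = h a"
      using chart_derivative_zero_imp_locally_constant[OF B] by blast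
    have "f b = f a" if b: "b \<in> T" for b
    proof -
      note S = subspace_tangent_space[OF F, of y]
      have h: "h y v w b = (f b)\<^sup>2 * gF y v (J b y w)" if v: "v \<in> tangent_space F y" for v b
        unfolding h_def J[OF w] by (rule gjj[OF v JT[OF w]])
      have eq: "gF y v ((f b)\<^sup>2 *\<^sub>R J b y w) = gF y v ((f a)\<^sup>2 *\<^sub>R J a y w)"
        if v: "v \<in> tangent_space F y" for v
        using T(3)[OF h'[OF _ _ v w] b] unfolding h[OF v]
        by (simp add: metric_scale_right[OF F gF v JT[OF w]])
      \<comment> \<open>\<open>eq\<close> says that both vectors pair equally with every
        \<open>v\<close>; testing with their difference, which depends on \<open>b\<close>, makes
        \<open>gF y D D\<close> zero. The neighbourhood \<open>T\<close> does not depend on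
        \<open>v\<close>, so this choice is legitimate.\<close>
      define D where "D = (f b)\<^sup>2 *\<^sub>R J b y w - (f a)\<^sup>2 *\<^sub>R J a y w"
      have sT: "r *\<^sub>R J b y w \<in> tangent_space F y" for r b by (rule subspace_scale[OF S JT[OF w]])
      have DT: "D \<in> tangent_space F y" unfolding D_def by (rule subspace_diff[OF S sT sT])
      have "gF y D (D + (f a)\<^sup>2 *\<^sub>R J a y w) = gF y D D + gF y D ((f a)\<^sup>2 *\<^sub>R J a y w)"
        by (rule metric_add_right[OF F gF DT DT sT])
      then have "gF y D D = 0" using eq[OF DT] by (simp add: D_def)
      then have "D = 0" using metric_pos[OF F gF DT DT] by force
      then have *: "(f b)\<^sup>2 *\<^sub>R J b y w = (f a)\<^sup>2 *\<^sub>R J a y w" by (simp add: D_def)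
      \<comment> \<open>The fourth power arises from a squared length with
        \<open>(f b)\<^sup>2\<close> in each slot; the isometry property removes the dependence on
        \<open>J\<close>, and positivity of \<open>f\<close> then permits taking roots.\<close>
      have norm: "gF y ((f b)\<^sup>2 *\<^sub>R J b y w) ((f b)\<^sup>2 *\<^sub>R J b y w) = (f b) ^ 4 * gF y w w" for b
        using metric_scale_right[OF F gF sT JT[OF w]] metric_scale_left[OF F gF JT[OF w] JT[OF w]]
          J_isometry[OF w] by (simp add: power_def)
      have "(f b) ^ 4 * gF y w w = (f a) ^ 4 * gF y w w"
        unfolding norm[symmetric] * ..
      then have "(f b) ^ 4 = (f a) ^ 4" using ww by simp
      then show ?thesis using f[of a] f[of b] by (simp add: power_eq_iff_eq_base)
    qed
    then have "\<forall>x\<in>T. f x = f a" by blast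
    moreover have "openin (top_of_set UNIV) T" using T(1) by simp
    ultimately show "\<exists>T. openin (top_of_set UNIV) T \<and> a \<in> T \<and> (\<forall>x\<in>T. f x = f a)"
      using T(2) by blast
  qed
  with assms(5) show False by contradiction
qed

end
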